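(* Let $n\ge 1$. The cells of $BC(1,n)$ are made up of exactly $$T(n) = 2V(n,n,2) + 2n(n+1)$$ triangles and $$Q(n) = V(n,n,1)-2V(n,n,2) -n^2$$ quadrilaterals (so every cell is a triangle or a quadrilateral, and the total number of cells is $T(n)+Q(n)$).
   Context: The planar graph $BC(1,n)$, $n\ge 1$: take the rectangle with vertices $(0,0),(n,0),(n,1),(0,1)$, with boundary points $(i,0)$ and $(i,1)$ for $0\le i\le n$ ($2n+2$ points: the four vertices together with $n-1$ equally spaced nodes on each of the two sides of length $n$). Join every pair of these boundary points by a straight line segment (a chord). The nodes of the graph are the $2n+2$ boundary points together with all points of the interior of the rectangle where two or more chords intersect; the edges are the line segments between consecutive nodes along the chords; the cells are the bounded connected regions (inside the rectangle) into which the edges divide the rectangle. A cell is a triangle (quadrilateral) if it is a polygon with three (four) sides. For integers $m,n,q\ge 1$, $$V(m,n,q)=\sum_{a=1}^{m}\ \sum_{\substack{1\le b\le n\\ \gcd(a,b)=q}} (m+1-a)(n+1-b).$$ *)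

theory Defs
  imports "HOL-Analysis.Analysis"
begin

definition BC_rect :: "nat \<Rightarrow> (real \<times> real) set" where
  "BC_rect n = cbox (0, 0) (real n, 1)"

definition BC_points :: "nat \<Rightarrow> (real \<times> real) set" where
  "BC_points n = {(real i, y) | i y. i \<le> n \<and> y \<in> {0, 1}}"

definition BC_chords :: "nat \<Rightarrow> (real \<times> real) set set" where
  "BC_chords n = {closed_segment p q | p q. p \<in> BC_points n \<and> q \<in> BC_points n \<and> p \<noteq> q}"

definition BC_nodes :: "nat \<Rightarrow> (real \<times> real) set" where
  "BC_nodes n = BC_points n \<union>
     {p \<in> interior (BC_rect n). \<exists>c \<in> BC_chords n. \<exists>d \<in> BC_chords n. c \<noteq> d \<and> p \<in> c \<and> p \<in> d}"

definition BC_edges :: "nat \<Rightarrow> (real \<times> real) set set" where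
  "BC_edges n = {closed_segment p q | p q. p \<in> BC_nodes n \<and> q \<in> BC_nodes n \<and> p \<noteq> q
     \<and> (\<exists>c \<in> BC_chords n. p \<in> c \<and> q \<in> c) \<and> open_segment p q \<inter> BC_nodes n = {}}"

text \<open>The sides of the rectangle are covered by edges, so the cells are open sets, and they are
  bounded because they lie in the rectangle.\<close>

definition BC_cells :: "nat \<Rightarrow> (real \<times> real) set set" where
  "BC_cells n = components (BC_rect n - \<Union> (BC_edges n))"

text \<open>Cells are open, so a cell is compared with the interior of a closed polygon. Polytopes are
  convex; this loses nothing, since every chord meeting the interior of the rectangle cuts the
  rectangle along a full line, and hence all cells are convex. The sides of a polygon are its
  one-dimensional faces.\<close>

definition polygon_with_sides :: "nat \<Rightarrow> (real \<times> real) set \<Rightarrow> bool" where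
  "polygon_with_sides k C \<longleftrightarrow>
     (\<exists>P. polytope P \<and> C = interior P \<and> C \<noteq> {} \<and> card {e. e edge_of P} = k)"

definition BC_triangles :: "nat \<Rightarrow> (real \<times> real) set set" where
  "BC_triangles n = {C \<in> BC_cells n. polygon_with_sides 3 C}"

definition BC_quadrilaterals :: "nat \<Rightarrow> (real \<times> real) set set" where
  "BC_quadrilaterals n = {C \<in> BC_cells n. polygon_with_sides 4 C}"

definition V :: "nat \<Rightarrow> nat \<Rightarrow> nat \<Rightarrow> int" where
  "V m n q = (\<Sum>a = 1..m. \<Sum>b | 1 \<le> b \<and> b \<le> n \<and> gcd a b = q.
                (int m + 1 - int a) * (int n + 1 - int b))"

definition T :: "nat \<Rightarrow> int" where
  "T n = 2 * V n n 2 + 2 * int n * (int n + 1)"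

definition Q :: "nat \<Rightarrow> int" where
  "Q n = V n n 1 - 2 * V n n 2 - (int n)\<^sup>2"

end

theory Submission
  imports Defs
begin

text \<open>
  Every chord that meets the open rectangle joins some \<open>(a, 0)\<close> to some \<open>(b, 1)\<close>; we regard it as the
  point \<open>(a, b)\<close> of the square grid \<open>{0..n}\<^sup>2\<close>. Dually, a point of the rectangle becomes a line of
  negative slope, an inner node a lattice line of negative slope with at least two grid points, and a
  cell a partition of the grid cut out by such a line.

  Apart from \<open>n\<close> triangles standing on the bottom side, a cell has a lowest vertex, where the chords
  \<open>s\<close> and \<open>t = s + D\<close> cross, with \<open>D\<close> primitive; these pairs number \<open>V(n,n,1) + n(n+1)\<close>, and each
  of them gives one cell. Apart from \<open>n\<close> triangles hanging from the top side, there is exactly one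
  \<open>X\<close> with \<open>det(X, D) = 1\<close> such that \<open>s + X\<close> and \<open>t - X\<close> are outside the square but \<open>t + X\<close> or
  \<open>s - X\<close> is inside. The cell is bounded by \<open>s\<close>, \<open>t\<close>, the last grid point on the ray from \<open>t\<close> in
  direction \<open>X\<close> if \<open>t + X\<close> is inside, and the last one on the ray from \<open>s\<close> in direction \<open>-X\<close> if
  \<open>s - X\<close> is inside. So it is a quadrilateral if both are inside and a triangle otherwise.

  The first alternative means that the cell has a vertex on its right, the second that it has one on
  its left. Each inner node is the right vertex of one cell and the left vertex of another one, and
  there are \<open>V(n,n,1) - V(n,n,2)\<close> inner nodes: pairs of neighbours on lattice lines minus pairs at
  distance two. Inclusion-exclusion gives the number of cells with both kinds of vertices.
\<close>

section \<open>Polygons as intersections of half-planes\<close>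

text \<open>The witnesses make the system of half-planes irredundant, so the facets of the closed
  polygon \<open>P\<close> correspond one to one to the indices; in the plane facets are
  edges.\<close>

lemma polygon_with_sides_halfplanes:
  fixes a :: "'i \<Rightarrow> real \<times> real"
  assumes fin: "finite I"
    and C: "C = {p. \<forall>i\<in>I. a i \<bullet> p < b i}" "C \<noteq> {}" "bounded C"
    and wit: "\<And>i. i \<in> I \<Longrightarrow> \<exists>w. a i \<bullet> w > b i \<and> (\<forall>j\<in>I. j \<noteq> i \<longrightarrow> a j \<bullet> w < b j)"
  shows "polygon_with_sides (card I) C"
proof -
  obtain z where z: "\<And>i. i \<in> I \<Longrightarrow> a i \<bullet> z < b i" using C(1,2) by auto
  have nz: "a i \<noteq> 0" if "i \<in> I" for i
    using z[OF that] wit[OF that] by auto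
  define H where "H i = {x. a i \<bullet> x \<le> b i}" for i
  define P where "P = \<Inter> (H ` I)"
  have intP: "interior P = C"
  proof -
    have "interior P = (\<Inter>i\<in>I. interior (H i))"
      unfolding P_def using fin by (induction rule: finite_induct) auto
    also have "\<dots> = (\<Inter>i\<in>I. {x. a i \<bullet> x < b i})"
      using nz by (intro INF_cong) (simp_all add: H_def)
    finally show ?thesis using C by auto
  qed
  have polyh: "polyhedron P"
    unfolding P_def using fin by (intro polyhedron_Inter) (auto simp: H_def polyhedron_halfspace_le)
  have "convex P" "closed P"
    using polyh polyhedron_imp_convex polyhedron_imp_closed by auto
  then have "P = closure C"
    using convex_closure_interior[of P] intP C(2) by simp
  then have "bounded P" using C(3) by (metis bounded_closure)
  then have polyt: "polytope P" using polyh polytope_eq_bounded_polyhedron by blast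
  have dimP: "aff_dim P = 2"
    using aff_dim_nonempty_interior[of P] intP C(2) by simp
  have affP: "affine hull P = UNIV"
    using affine_hull_nonempty_interior[of P] intP C(2) by simp
  obtain w where w: "\<And>i. i \<in> I \<Longrightarrow> a i \<bullet> w i > b i"
    "\<And>i j. i \<in> I \<Longrightarrow> j \<in> I \<Longrightarrow> j \<noteq> i \<Longrightarrow> a j \<bullet> w i < b j"
    using wit by metis
  have H_w: "w i \<in> H j \<longleftrightarrow> j \<noteq> i" if "i \<in> I" "j \<in> I" for i j
    using w that unfolding H_def by (metis linorder_not_less mem_Collect_eq order_less_imp_le)
  have injH: "inj_on H I"
    using H_w by (intro inj_onI) metis
  define e where "e i = P \<inter> {x. a i \<bullet> x = b i}" for i
  \<comment> \<open>The segment from the inner point \<open>z\<close> to the witness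
    \<open>w i\<close> crosses the line of index \<open>i\<close> at \<open>x\<close>, where all
    other inequalities are still strict. Hence different indices give different sides.\<close>
  have e_pt: "\<exists>x\<in>e i. \<forall>j\<in>I - {i}. a j \<bullet> x < b j" if i: "i \<in> I" for i
  proof -
    define t where "t = (b i - a i \<bullet> z) / (a i \<bullet> w i - a i \<bullet> z)"
    define x where "x = (1 - t) *\<^sub>R z + t *\<^sub>R w i"
    have t: "0 < t" "t < 1"
      using z[OF i] w(1)[OF i] by (auto simp: t_def)
    have aix: "a i \<bullet> x = b i"
    proof -
      have "a i \<bullet> x = a i \<bullet> z + t * (a i \<bullet> w i - a i \<bullet> z)"
        by (simp add: x_def inner_add_right algebra_simps)
      then show ?thesis using z[OF i] w(1)[OF i] by (simp add: t_def)
    qed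
    have ajx: "a j \<bullet> x < b j" if "j \<in> I" "j \<noteq> i" for j
    proof -
      have "(1 - t) * (a j \<bullet> z) + t * (a j \<bullet> w i) < (1 - t) * b j + t * b j"
        using z[OF that(1)] w(2)[OF i that] t by (intro add_strict_mono mult_strict_left_mono) auto
      then show ?thesis by (simp add: x_def inner_add_right algebra_simps)
    qed
    have "x \<in> P" using aix ajx by (force simp: P_def H_def)
    then show ?thesis using aix ajx by (auto simp: e_def)
  qed
  have injE: "inj_on e I"
  proof (rule inj_onI, rule ccontr)
    fix i j assume ij: "i \<in> I" "j \<in> I" "e i = e j" "i \<noteq> j"
    obtain x where "x \<in> e j" "a j \<bullet> x < b j" using e_pt[OF ij(1)] ij by auto
    then show False by (simp add: e_def)
  qed
  have facet: "c facet_of P \<longleftrightarrow> (\<exists>h. h \<in> H ` I \<and> c = P \<inter> {x. a (inv_into I H h) \<bullet> x = b (inv_into I H h)})" for c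
  proof (rule facet_of_polyhedron_explicit)
    show "finite (H ` I)" using fin by simp
    show "P = affine hull P \<inter> \<Inter> (H ` I)" using affP by (simp add: P_def)
    show "a (inv_into I H h) \<noteq> 0 \<and> h = {x. a (inv_into I H h) \<bullet> x \<le> b (inv_into I H h)}"
      if "h \<in> H ` I" for h
      using nz that injH by (auto simp: H_def[symmetric])
    \<comment> \<open>Dropping the half-plane \<open>H i\<close> admits its witness
      \<open>w i\<close>, so no proper subfamily cuts out \<open>P\<close>.\<close>
    show "P \<subset> affine hull P \<inter> \<Inter> F'" if F': "F' \<subset> H ` I" for F'
    proof -
      obtain i where i: "i \<in> I" "H i \<notin> F'" using F' by blast
      have "w i \<in> \<Inter> F'" using F' i H_w by blast
      moreover have "w i \<notin> P" using i H_w by (auto simp: P_def)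
      moreover have "P \<subseteq> \<Inter> F'" using F' by (auto simp: P_def)
      ultimately show ?thesis by (auto simp: affP)
    qed
  qed
  have "{c. c edge_of P} = {c. c facet_of P}"
  proof -
    have "c \<noteq> {}" if "aff_dim c = 1" for c :: "(real \<times> real) set"
      using that by force
    then show ?thesis by (auto simp: edge_of_def facet_of_def dimP)
  qed
  also have "\<dots> = e ` I"
    using facet injH by (auto simp: e_def inv_into_f_f)
  finally have "card {c. c edge_of P} = card I"
    using injE by (simp add: card_image)
  then show ?thesis
    unfolding polygon_with_sides_def using polyt intP C(2) by blast
qed

text \<open>A closed convex set with nonempty interior is the closure of that interior, so
  \<open>C\<close> determines the polygon and the number of its sides.\<close>

lemma polygon_with_sides_unique:
  assumes "polygon_with_sides k C" "polygon_with_sides l C"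
  shows "k = l"
proof -
  have "P = closure C" if "polytope P" "C = interior P" "C \<noteq> {}" for P
    using that convex_closure_interior[of P] polytope_imp_convex polytope_imp_closed by force
  then show ?thesis using assms unfolding polygon_with_sides_def by metis
qed

lemma polygon_with_three_sides:
  fixes a1 a2 a3 :: "real \<times> real"
  assumes "C = {p. a1 \<bullet> p < b1 \<and> a2 \<bullet> p < b2 \<and> a3 \<bullet> p < b3}" "C \<noteq> {}" "bounded C"
    and "\<exists>w. a1 \<bullet> w > b1 \<and> a2 \<bullet> w < b2 \<and> a3 \<bullet> w < b3"
    and "\<exists>w. a1 \<bullet> w < b1 \<and> a2 \<bullet> w > b2 \<and> a3 \<bullet> w < b3"
    and "\<exists>w. a1 \<bullet> w < b1 \<and> a2 \<bullet> w < b2 \<and> a3 \<bullet> w > b3"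
  shows "polygon_with_sides 3 C"
proof -
  have "polygon_with_sides (card {0::nat, 1, 2}) C"
    by (rule polygon_with_sides_halfplanes[where a = "(!) [a1, a2, a3]" and b = "(!) [b1, b2, b3]"])
      (use assms in \<open>auto simp del: split_paired_Ex\<close>)
  then show ?thesis by (simp add: eval_nat_numeral)
qed

lemma polygon_with_four_sides:
  fixes a1 a2 a3 a4 :: "real \<times> real"
  assumes "C = {p. a1 \<bullet> p < b1 \<and> a2 \<bullet> p < b2 \<and> a3 \<bullet> p < b3 \<and> a4 \<bullet> p < b4}" "C \<noteq> {}" "bounded C"
    and "\<exists>w. a1 \<bullet> w > b1 \<and> a2 \<bullet> w < b2 \<and> a3 \<bullet> w < b3 \<and> a4 \<bullet> w < b4"
    and "\<exists>w. a1 \<bullet> w < b1 \<and> a2 \<bullet> w > b2 \<and> a3 \<bullet> w < b3 \<and> a4 \<bullet> w < b4"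
    and "\<exists>w. a1 \<bullet> w < b1 \<and> a2 \<bullet> w < b2 \<and> a3 \<bullet> w > b3 \<and> a4 \<bullet> w < b4"
    and "\<exists>w. a1 \<bullet> w < b1 \<and> a2 \<bullet> w < b2 \<and> a3 \<bullet> w < b3 \<and> a4 \<bullet> w > b4"
  shows "polygon_with_sides 4 C"
proof -
  have "polygon_with_sides (card {0::nat, 1, 2, 3}) C"
    by (rule polygon_with_sides_halfplanes
        [where a = "(!) [a1, a2, a3, a4]" and b = "(!) [b1, b2, b3, b4]"])
      (use assms in \<open>auto simp: numeral_3_eq_3 simp del: split_paired_Ex\<close>)
  then show ?thesis by (simp add: eval_nat_numeral)
qed

section \<open>Cells as sign classes of the chords\<close>

text \<open>The chord from \<open>(a, 0)\<close> to \<open>(b, 1)\<close> is encoded by the grid point \<open>(a, b)\<close>; its function is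
  positive exactly to the left of the chord. The two vertical sides are the chords \<open>(0, 0)\<close> and
  \<open>(n, n)\<close>, so that no condition on the first coordinate occurs in \<open>cell_of\<close>.\<close>

definition chord_fun :: "int \<times> int \<Rightarrow> real \<times> real \<Rightarrow> real" where
  "chord_fun w p = of_int (fst w) * (1 - snd p) + of_int (snd w) * snd p - fst p"

definition grid :: "nat \<Rightarrow> (int \<times> int) set" where
  "grid n = {0..int n} \<times> {0..int n}"

text \<open>\<open>S\<close> collects the chords that pass to the left of the cell.\<close>

definition cell_of :: "nat \<Rightarrow> (int \<times> int) set \<Rightarrow> (real \<times> real) set" where
  "cell_of n S = {p. 0 < snd p \<and> snd p < 1 \<and>
     (\<forall>w\<in>grid n. (w \<in> S \<longrightarrow> chord_fun w p < 0) \<and> (w \<notin> S \<longrightarrow> chord_fun w p > 0))}"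

lemma finite_grid [simp]: "finite (grid n)"
  by (simp add: grid_def)

lemma chord_fun_iff_inner:
  "chord_fun w p < 0 \<longleftrightarrow> (-1, of_int (snd w - fst w)) \<bullet> p < of_int (- fst w)"
  "chord_fun w p > 0 \<longleftrightarrow> (1, of_int (fst w - snd w)) \<bullet> p < of_int (fst w)"
  by (auto simp: chord_fun_def inner_prod_def algebra_simps)

lemma open_cell_of: "open (cell_of n S)"
proof -
  have "cell_of n S = {p. 0 < snd p} \<inter> {p. snd p < 1} \<inter>
     (\<Inter>w\<in>grid n. if w \<in> S then {p. chord_fun w p < 0} else {p. chord_fun w p > 0})"
    by (auto simp: cell_of_def)
  also have "open \<dots>"
    unfolding chord_fun_def
    by (intro open_Int open_INT finite_grid ballI)
      (auto intro!: open_Collect_less continuous_intros)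
  finally show ?thesis .
qed

lemma convex_cell_of: "convex (cell_of n S)"
proof -
  have *: "convex {p::real\<times>real. 0 < snd p}" "convex {p::real\<times>real. snd p < 1}"
    using convex_halfspace_lt[of "(0,-1)::real\<times>real" 0] convex_halfspace_lt[of "(0,1)::real\<times>real" 1]
    by (auto simp: inner_prod_def)
  have **: "convex {p. chord_fun w p < 0}" "convex {p. chord_fun w p > 0}" for w
    unfolding chord_fun_iff_inner by (rule convex_halfspace_lt)+
  have "cell_of n S = {p. 0 < snd p} \<inter> {p. snd p < 1} \<inter>
     (\<Inter>w\<in>grid n. if w \<in> S then {p. chord_fun w p < 0} else {p. chord_fun w p > 0})"
    by (auto simp: cell_of_def)
  also have "convex \<dots>"
    using * ** by (intro convex_Int convex_INT) auto
  finally show ?thesis .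
qed

text \<open>Among the pairs of points of \<open>N\<close> whose segment contains \<open>r\<close>
  and stays inside the given one, a closest pair is taken: a point of \<open>N\<close> strictly
  between would yield a closer pair. This cuts chords into edges.\<close>

lemma closed_segment_between_consecutive:
  fixes p q :: "'a::euclidean_space"
  assumes "finite N" "p \<in> N" "q \<in> N" "p \<noteq> q" "r \<in> closed_segment p q"
  shows "\<exists>p'\<in>N. \<exists>q'\<in>N. p' \<noteq> q' \<and> r \<in> closed_segment p' q' \<and>
    closed_segment p' q' \<subseteq> closed_segment p q \<and> open_segment p' q' \<inter> N = {}"
proof -
  define A where "A = {(p', q'). p' \<in> N \<and> q' \<in> N \<and> p' \<noteq> q' \<and> r \<in> closed_segment p' q' \<and>
    closed_segment p' q' \<subseteq> closed_segment p q}"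
  have "A \<subseteq> N \<times> N" by (auto simp: A_def)
  then have "finite A" using assms(1) finite_subset by blast
  moreover have "A \<noteq> {}" using assms by (auto simp: A_def)
  ultimately obtain x where x: "x \<in> A" "\<And>y. y \<in> A \<Longrightarrow> \<not> dist (fst y) (snd y) < dist (fst x) (snd x)"
    using ex_min_if_finite[of "(\<lambda>y. dist (fst y) (snd y)) ` A"] by auto
  obtain p' q' where pq: "x = (p', q')" by force
  have "open_segment p' q' \<inter> N = {}"
  proof (rule ccontr)
    assume "open_segment p' q' \<inter> N \<noteq> {}"
    then obtain m where m: "m \<in> open_segment p' q'" "m \<in> N" by auto
    have mc: "m \<in> closed_segment p' q'" "m \<noteq> p'" "m \<noteq> q'"
      using m(1) by (auto simp: open_segment_def)
    have d: "dist p' m < dist p' q'" "dist m q' < dist p' q'"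
      using dist_in_open_segment[OF m(1)] by (auto simp: dist_commute)
    have un: "closed_segment p' m \<union> closed_segment m q' = closed_segment p' q'"
      using Un_closed_segment[OF mc(1)] .
    have "(p', m) \<in> A \<or> (m, q') \<in> A"
      using x(1) un mc(2,3) m(2) unfolding pq A_def by blast
    then show False using x(2) d pq by fastforce
  qed
  then show ?thesis using x(1) pq by (auto simp: A_def)
qed

section \<open>Chords as zero sets, and the passage from edges to chords\<close>

lemma closed_segment_chord:
  "closed_segment (of_int (fst w), 0) (of_int (snd w), 1) =
    {p. 0 \<le> snd p \<and> snd p \<le> 1 \<and> chord_fun w p = 0}"
proof (intro set_eqI iffI)
  fix p :: "real \<times> real"
  assume "p \<in> closed_segment (of_int (fst w), 0) (of_int (snd w), 1)"
  then show "p \<in> {p. 0 \<le> snd p \<and> snd p \<le> 1 \<and> chord_fun w p = 0}"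
    by (auto simp: in_segment chord_fun_def algebra_simps)
next
  fix p :: "real \<times> real"
  assume p: "p \<in> {p. 0 \<le> snd p \<and> snd p \<le> 1 \<and> chord_fun w p = 0}"
  then have "p = (1 - snd p) *\<^sub>R (of_int (fst w), 0) + snd p *\<^sub>R (of_int (snd w), 1)"
    by (auto simp: chord_fun_def prod_eq_iff algebra_simps)
  then show "p \<in> closed_segment (of_int (fst w), 0) (of_int (snd w), 1)"
    using p unfolding in_segment by blast
qed

lemma interior_BC_rect: "interior (BC_rect n) = {p. 0 < fst p \<and> fst p < real n \<and> 0 < snd p \<and> snd p < 1}"
  by (auto simp: BC_rect_def box_def Basis_prod_def inner_prod_def)

lemma BC_rect_eq: "BC_rect n = {p. 0 \<le> fst p \<and> fst p \<le> real n \<and> 0 \<le> snd p \<and> snd p \<le> 1}"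
  by (auto simp: BC_rect_def cbox_def Basis_prod_def inner_prod_def)

text \<open>A chord with both ends on the same horizontal side never enters the open strip. So the
  ends lie on opposite sides, and the two cases are the two orientations of the chord.\<close>

lemma chord_interior:
  assumes "c \<in> BC_chords n" "p \<in> c" "0 < snd p" "snd p < 1"
  obtains w where "w \<in> grid n" "c = {p. 0 \<le> snd p \<and> snd p \<le> 1 \<and> chord_fun w p = 0}"
proof -
  obtain i y j z where c: "c = closed_segment (real i, y) (real j, z)" "i \<le> n" "j \<le> n"
      "y \<in> {0,1}" "z \<in> {0,1}"
    using assms(1) by (auto simp: BC_chords_def BC_points_def)
  obtain u where u: "0 \<le> u" "u \<le> 1" "p = (1 - u) *\<^sub>R (real i, y) + u *\<^sub>R (real j, z)"
    using assms(2) c(1) by (auto simp: in_segment)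
  have "y \<noteq> z"
    using assms(3,4) u c(4,5) by (auto simp: algebra_simps)
  then consider "y = 0" "z = 1" | "y = 1" "z = 0" using c by auto
  then show thesis
  proof cases
    case 1
    then have "c = closed_segment (of_int (fst (int i, int j)), 0) (of_int (snd (int i, int j)), 1)"
      using c by simp
    then show ?thesis using that[of "(int i, int j)"] c unfolding closed_segment_chord
      by (simp add: grid_def)
  next
    case 2
    then have "c = closed_segment (of_int (fst (int j, int i)), 0) (of_int (snd (int j, int i)), 1)"
      using c by (simp add: closed_segment_commute)
    then show ?thesis using that[of "(int j, int i)"] c unfolding closed_segment_chord
      by (simp add: grid_def)
  qed
qed

lemma grid_chord:
  assumes "w \<in> grid n"
  shows "{p. 0 \<le> snd p \<and> snd p \<le> 1 \<and> chord_fun w p = 0} \<in> BC_chords n"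
proof -
  have "(of_int (fst w), 0) \<in> BC_points n" "(of_int (snd w), 1) \<in> BC_points n"
    using assms by (auto simp: BC_points_def grid_def dest!: zero_le_imp_eq_int)
  then show ?thesis
    unfolding closed_segment_chord[symmetric] BC_chords_def
    by (intro CollectI exI[of _ "(of_int (fst w), 0)"] exI[of _ "(of_int (snd w), 1)"]) auto
qed

lemma finite_BC_points: "finite (BC_points n)"
proof -
  have "BC_points n = (\<lambda>(i, y). (real i, y)) ` ({..n} \<times> {0, 1})"
    by (auto simp: BC_points_def image_def)
  then show ?thesis by simp
qed

text \<open>Distinct grid points give distinct lines, which share at most one point, and there are
  finitely many pairs. Finiteness is what allows a chord to be cut at consecutive nodes.\<close>

lemma finite_BC_nodes: "finite (BC_nodes n)"
proof -
  define g where "g v w = {p. chord_fun v p = 0 \<and> chord_fun w p = 0}" for v w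
  have fin: "finite (g v w)" if "v \<noteq> w" for v w
  proof -
    have "is_singleton (g v w) \<or> g v w = {}"
    proof -
      have "p = q" if "p \<in> g v w" "q \<in> g v w" for p q
      proof -
        define a b :: real where "a = of_int (fst v - fst w)" and "b = of_int (snd v - snd w)"
        have ab: "a \<noteq> 0 \<or> b \<noteq> 0" using \<open>v \<noteq> w\<close> by (auto simp: a_def b_def prod_eq_iff)
        have "a * (1 - snd p) + b * snd p = 0" "a * (1 - snd q) + b * snd q = 0"
          using that by (auto simp: g_def chord_fun_def a_def b_def algebra_simps)
        \<comment> \<open>If \<open>a = b\<close>, the lines are parallel, and a common point forces
          both differences to vanish.\<close>
        then have "(b - a) * (snd p - snd q) = 0" "b = a \<Longrightarrow> a = 0"
          by (auto simp: algebra_simps)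
        then have "snd p = snd q" using ab by auto
        then show ?thesis using that by (auto simp: g_def chord_fun_def prod_eq_iff)
      qed
      then show ?thesis by (meson ex_in_conv is_singletonI')
    qed
    then show ?thesis by (auto simp: is_singleton_def)
  qed
  have "{p \<in> interior (BC_rect n). \<exists>c\<in>BC_chords n. \<exists>d\<in>BC_chords n. c \<noteq> d \<and> p \<in> c \<and> p \<in> d}
     \<subseteq> (\<Union>x\<in>{x \<in> grid n \<times> grid n. fst x \<noteq> snd x}. g (fst x) (snd x))"
  proof clarify
    fix p1 p2 c d
    assume *: "(p1, p2) \<in> interior (BC_rect n)" "c \<in> BC_chords n" "d \<in> BC_chords n"
      "c \<noteq> d" "(p1, p2) \<in> c" "(p1, p2) \<in> d"
    have y: "0 < p2" "p2 < 1" using *(1) by (auto simp: interior_BC_rect)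
    obtain v where v: "v \<in> grid n" "c = {p. 0 \<le> snd p \<and> snd p \<le> 1 \<and> chord_fun v p = 0}"
      using chord_interior[OF *(2,5)] y by auto
    obtain w where w: "w \<in> grid n" "d = {p. 0 \<le> snd p \<and> snd p \<le> 1 \<and> chord_fun w p = 0}"
      using chord_interior[OF *(3,6)] y by auto
    have "(p1, p2) \<in> g v w" using * v w by (auto simp: g_def)
    then show "(p1, p2) \<in> (\<Union>x\<in>{x \<in> grid n \<times> grid n. fst x \<noteq> snd x}. g (fst x) (snd x))"
      using v w *(4) by (intro UN_I[of "(v, w)"]) auto
  qed
  moreover have "finite (\<Union>x\<in>{x \<in> grid n \<times> grid n. fst x \<noteq> snd x}. g (fst x) (snd x))"
    by (intro finite_UN_I fin) auto
  ultimately show ?thesis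
    unfolding BC_nodes_def by (intro finite_UnI finite_BC_points) (rule finite_subset)
qed

text \<open>From here on edges and nodes can be forgotten: the cells are the components of the
  complement of the chords.\<close>

lemma Union_BC_edges: "\<Union> (BC_edges n) = \<Union> (BC_chords n)"
proof
  show "\<Union> (BC_edges n) \<subseteq> \<Union> (BC_chords n)"
  proof
    fix r assume "r \<in> \<Union> (BC_edges n)"
    then obtain p q c where *: "r \<in> closed_segment p q" "c \<in> BC_chords n" "p \<in> c" "q \<in> c"
      by (auto simp: BC_edges_def)
    have "convex c" using *(2) by (auto simp: BC_chords_def)
    then have "r \<in> c" using * by (meson closed_segment_subset subsetD)
    then show "r \<in> \<Union> (BC_chords n)" using * by auto
  qed
  show "\<Union> (BC_chords n) \<subseteq> \<Union> (BC_edges n)"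
  proof
    fix r assume "r \<in> \<Union> (BC_chords n)"
    then obtain p q where pq: "p \<in> BC_points n" "q \<in> BC_points n" "p \<noteq> q" "r \<in> closed_segment p q"
      by (auto simp: BC_chords_def)
    then have c: "closed_segment p q \<in> BC_chords n" unfolding BC_chords_def by blast
    have "p \<in> BC_nodes n" "q \<in> BC_nodes n" using pq by (auto simp: BC_nodes_def)
    from closed_segment_between_consecutive[OF finite_BC_nodes this pq(3,4)]
    obtain p' q' where *: "p' \<in> BC_nodes n" "q' \<in> BC_nodes n" "p' \<noteq> q'" "r \<in> closed_segment p' q'"
       "closed_segment p' q' \<subseteq> closed_segment p q" "open_segment p' q' \<inter> BC_nodes n = {}" by blast
    have "p' \<in> closed_segment p q" "q' \<in> closed_segment p q" using *(5) by auto
    then have "closed_segment p' q' \<in> BC_edges n"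
      unfolding BC_edges_def using * c by blast
    then show "r \<in> \<Union> (BC_edges n)" using *(4) by blast
  qed
qed

text \<open>The horizontal sides are chords too, with distinct ends because
  \<open>n \<ge> 1\<close>, but they are no zero sets of a \<open>chord_fun\<close>. Removing them
  yields the strict bounds on \<open>snd p\<close>.\<close>

lemma BC_rect_minus_edges:
  assumes "n \<ge> 1"
  shows "BC_rect n - \<Union> (BC_edges n) = {p. 0 < fst p \<and> fst p < real n \<and> 0 < snd p \<and> snd p < 1 \<and>
    (\<forall>w\<in>grid n. chord_fun w p \<noteq> 0)}" (is "?L = ?R")
proof
  show "?L \<subseteq> ?R"
  proof
    fix p assume p: "p \<in> ?L"
    have pr: "0 \<le> fst p" "fst p \<le> real n" "0 \<le> snd p" "snd p \<le> 1"
      using p by (auto simp: BC_rect_eq)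
    have nc: "p \<notin> c" if "c \<in> BC_chords n" for c
      using p that unfolding Union_BC_edges by blast
    have nz: "chord_fun w p \<noteq> 0" if "w \<in> grid n" for w
      using nc[OF grid_chord[OF that]] pr by simp
    have hor: "p \<notin> closed_segment (0, y) (real n, y)" if "y \<in> {0, 1}" for y
    proof (intro nc)
      have "(0, y) \<in> BC_points n" "(real n, y) \<in> BC_points n"
        using that by (auto simp: BC_points_def)
      moreover have "(0, y) \<noteq> (real n, y)" using assms by simp
      ultimately show "closed_segment (0, y) (real n, y) \<in> BC_chords n"
        unfolding BC_chords_def by blast
    qed
    have hor': "(fst p, y) \<in> closed_segment (0, y) (real n, y)" for y
    proof -
      have "(fst p, y) = (1 - fst p / n) *\<^sub>R (0, y) + (fst p / n) *\<^sub>R (real n, y)"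
        using assms by (simp add: algebra_simps)
      moreover have "0 \<le> fst p / n" "fst p / n \<le> 1" using pr assms by auto
      ultimately show ?thesis unfolding in_segment by blast
    qed
    have "snd p \<noteq> 0" "snd p \<noteq> 1"
      using hor[of 0] hor[of 1] hor'[of 0] hor'[of 1] by (metis insertCI prod.collapse)+
    moreover have "fst p \<noteq> 0" "fst p \<noteq> real n"
      using nz[of "(0, 0)"] nz[of "(int n, int n)"] by (auto simp: grid_def chord_fun_def algebra_simps)
    ultimately show "p \<in> ?R" using pr nz by auto
  qed
  show "?R \<subseteq> ?L"
  proof
    fix p assume p: "p \<in> ?R"
    have "p \<notin> c" if "c \<in> BC_chords n" for c
      using chord_interior[OF that, of p] p by blast
    then show "p \<in> ?L" using p by (auto simp: BC_rect_eq Union_BC_edges)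
  qed
qed

lemma cell_of_subset_box:
  assumes "(0, 0) \<in> S" "(int n, int n) \<notin> S" "p \<in> cell_of n S"
  shows "0 < fst p" "fst p < real n"
proof -
  have "(0, 0) \<in> grid n" "(int n, int n) \<in> grid n" by (auto simp: grid_def)
  then have "chord_fun (0, 0) p < 0" "chord_fun (int n, int n) p > 0"
    using assms by (auto simp: cell_of_def)
  then show "0 < fst p" "fst p < real n" by (auto simp: chord_fun_def algebra_simps)
qed

text \<open>Disjoint nonempty open connected sets that cover a set are its components. The last
  assumption, that the sign class of every generic point belongs to the family, provides the
  covering.\<close>

lemma BC_cells_eq:
  assumes n: "n \<ge> 1"
    and 1: "\<And>S. S \<in> \<S> \<Longrightarrow> S \<subseteq> grid n \<and> (0, 0) \<in> S \<and> (int n, int n) \<notin> S"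
    and 2: "\<And>S. S \<in> \<S> \<Longrightarrow> cell_of n S \<noteq> {}"
    and 3: "\<And>p. 0 < fst p \<Longrightarrow> fst p < real n \<Longrightarrow> 0 < snd p \<Longrightarrow> snd p < 1 \<Longrightarrow>
      (\<And>w. w \<in> grid n \<Longrightarrow> chord_fun w p \<noteq> 0) \<Longrightarrow> {w \<in> grid n. chord_fun w p < 0} \<in> \<S>"
  shows "BC_cells n = cell_of n ` \<S>" "inj_on (cell_of n) \<S>"
proof -
  \<comment> \<open>A single point of a cell recovers \<open>S\<close>; this gives both injectivity
    and disjointness.\<close>
  have eq: "S = {w \<in> grid n. chord_fun w p < 0}" if "S \<in> \<S>" "p \<in> cell_of n S" for S p
  proof -
    have "w \<in> S \<longleftrightarrow> chord_fun w p < 0" if "w \<in> grid n" for w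
      using \<open>p \<in> cell_of n S\<close> that unfolding cell_of_def by (metis (mono_tags, lifting) mem_Collect_eq order_less_asym)
    then show ?thesis using 1[OF that(1)] by blast
  qed
  show "inj_on (cell_of n) \<S>"
  proof (rule inj_onI)
    fix S S' assume "S \<in> \<S>" "S' \<in> \<S>" "cell_of n S = cell_of n S'"
    moreover then obtain p where "p \<in> cell_of n S" using 2 by blast
    ultimately show "S = S'" using eq[of S p] eq[of S' p] by simp
  qed
  show "BC_cells n = cell_of n ` \<S>"
    unfolding BC_cells_def
  proof (rule components_open_unique)
    show "pairwise disjnt (cell_of n ` \<S>)"
    proof (rule pairwiseI)
      fix C D assume "C \<in> cell_of n ` \<S>" "D \<in> cell_of n ` \<S>" "C \<noteq> D"
      then obtain S S' where *: "S \<in> \<S>" "S' \<in> \<S>" "C = cell_of n S" "D = cell_of n S'" by auto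
      have "S = S'" if "p \<in> C" "p \<in> D" for p
        using that eq[of S p] eq[of S' p] * by simp
      then show "disjnt C D"
        unfolding disjnt_iff using *(3,4) \<open>C \<noteq> D\<close> by blast
    qed
    show "open X \<and> connected X \<and> X \<noteq> {}" if "X \<in> cell_of n ` \<S>" for X
      using that 2 open_cell_of convex_cell_of convex_connected by blast
    show "\<Union> (cell_of n ` \<S>) = BC_rect n - \<Union> (BC_edges n)"
      unfolding BC_rect_minus_edges[OF n]
    proof (intro set_eqI iffI)
      fix p assume "p \<in> \<Union> (cell_of n ` \<S>)"
      then obtain S where S: "S \<in> \<S>" "p \<in> cell_of n S" by auto
      then have "0 < fst p" "fst p < real n"
        using 1[OF S(1)] cell_of_subset_box[of S n p] by auto
      then show "p \<in> {p. 0 < fst p \<and> fst p < real n \<and> 0 < snd p \<and> snd p < 1 \<and>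
          (\<forall>w\<in>grid n. chord_fun w p \<noteq> 0)}"
        using S(2) unfolding cell_of_def by (auto dest!: bspec)
    next
      fix p assume p: "p \<in> {p. 0 < fst p \<and> fst p < real n \<and> 0 < snd p \<and> snd p < 1 \<and>
          (\<forall>w\<in>grid n. chord_fun w p \<noteq> 0)}"
      define S where "S = {w \<in> grid n. chord_fun w p < 0}"
      have "S \<in> \<S>" using p 3[of p] by (simp add: S_def)
      moreover have "p \<in> cell_of n S"
        using p by (auto simp: cell_of_def S_def neq_iff)
      ultimately show "p \<in> \<Union> (cell_of n ` \<S>)" by blast
    qed
  qed
qed

section \<open>Lattice geometry of the square grid\<close>

definition inbox :: "int \<Rightarrow> int \<Rightarrow> int \<Rightarrow> bool" where
  "inbox n a b \<longleftrightarrow> 0 \<le> a \<and> a \<le> n \<and> 0 \<le> b \<and> b \<le> n"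

lemma inbox_reflect: "inbox n (n - a) (n - b) \<longleftrightarrow> inbox n a b"
  by (auto simp: inbox_def)

text \<open>Here \<open>z\<close> is the convex combination of \<open>u\<close>, \<open>v\<close>,
  \<open>w\<close> with weights \<open>1/c\<close>, \<open>p/c\<close>, \<open>q/c\<close>, written
  with denominators cleared.\<close>

lemma convex_interval_int:
  fixes z :: int
  assumes "c * z = u + p * v + q * w" "c = 1 + p + q" "0 \<le> p" "0 \<le> q"
    "0 \<le> u" "u \<le> n" "0 \<le> v" "v \<le> n" "0 \<le> w" "w \<le> n"
  shows "0 \<le> z" "z \<le> n"
proof -
  have c: "c > 0" using assms by simp
  have "0 \<le> c * z" unfolding assms(1) using assms by simp
  then show "0 \<le> z" using c by (simp add: zero_le_mult_iff)
  have "p * v \<le> p * n" "q * w \<le> q * n" using assms by (simp_all add: mult_left_mono)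
  then have "c * z \<le> c * n" unfolding assms(1) using assms(2,6) by (simp add: algebra_simps)
  then show "z \<le> n" using c by simp
qed

lemma inbox_convex:
  assumes "c * a = a1 + p * a2 + q * a3" "c * b = b1 + p * b2 + q * b3" "c = 1 + p + q"
    "0 \<le> p" "0 \<le> q" "inbox n a1 b1" "inbox n a2 b2" "inbox n a3 b3"
  shows "inbox n a b"
  using assms convex_interval_int[OF assms(1,3,4,5), of n] convex_interval_int[OF assms(2,3,4,5), of n]
  by (auto simp: inbox_def)

text \<open>Throughout, \<open>s = (sx, sy)\<close>, \<open>D = (-\<alpha>, \<beta>)\<close>, \<open>t = s + D\<close> and \<open>X = (x, -y)\<close>. The chords \<open>s\<close> and
  \<open>t\<close> are the left and the right side of a cell directly above its lowest vertex. The other sides, if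
  any, are the chords \<open>t + A X\<close> (when \<open>A \<ge> 1\<close>, meeting \<open>t\<close> in a vertex on the right) and \<open>s - B X\<close>
  (when \<open>B \<ge> 1\<close>, meeting \<open>s\<close> in a vertex on the left).\<close>

definition corner :: "int \<Rightarrow> int \<Rightarrow> int \<Rightarrow> int \<Rightarrow> int \<Rightarrow> bool" where
  "corner n sx sy \<alpha> \<beta> \<longleftrightarrow> 0 \<le> \<alpha> \<and> 1 \<le> \<beta> \<and> coprime \<alpha> \<beta> \<and>
    inbox n sx sy \<and> inbox n (sx - \<alpha>) (sy + \<beta>)"

text \<open>The equation is \<open>det(X, D) = 1\<close>; the last two conditions put
  \<open>s + X\<close> and \<open>t - X\<close> outside the box.\<close>

definition side_dir :: "int \<Rightarrow> int \<Rightarrow> int \<Rightarrow> int \<Rightarrow> int \<Rightarrow> int \<Rightarrow> int \<Rightarrow> bool" where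
  "side_dir n sx sy \<alpha> \<beta> x y \<longleftrightarrow> 1 \<le> x \<and> 1 \<le> y \<and> x * \<beta> - y * \<alpha> = 1 \<and>
    \<not> inbox n (sx + x) (sy - y) \<and> \<not> inbox n (sx - \<alpha> - x) (sy + \<beta> + y)"

definition right_vertex :: "int \<Rightarrow> int \<Rightarrow> int \<Rightarrow> int \<Rightarrow> int \<Rightarrow> int \<Rightarrow> int \<Rightarrow> bool" where
  "right_vertex n sx sy \<alpha> \<beta> x y \<longleftrightarrow> inbox n (sx - \<alpha> + x) (sy + \<beta> - y)"

definition left_vertex :: "int \<Rightarrow> int \<Rightarrow> int \<Rightarrow> int \<Rightarrow> int \<Rightarrow> bool" where
  "left_vertex n sx sy x y \<longleftrightarrow> inbox n (sx - x) (sy + y)"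

text \<open>The half turn of the square exchanges the roles of \<open>s\<close> and \<open>t\<close>
  and preserves \<open>D\<close> and \<open>X\<close>. It interchanges left and right, so one-sided
  statements need only one proof.\<close>

lemma corner_reflect:
  "corner n (n - sx + \<alpha>) (n - sy - \<beta>) \<alpha> \<beta> \<longleftrightarrow> corner n sx sy \<alpha> \<beta>"
  by (auto simp: corner_def inbox_def)

lemma side_dir_reflect:
  "side_dir n (n - sx + \<alpha>) (n - sy - \<beta>) \<alpha> \<beta> x y \<longleftrightarrow> side_dir n sx sy \<alpha> \<beta> x y"
  by (auto simp: side_dir_def inbox_def)

lemma right_vertex_reflect:
  "right_vertex n (n - sx + \<alpha>) (n - sy - \<beta>) \<alpha> \<beta> x y \<longleftrightarrow> left_vertex n sx sy x y"
  by (auto simp: left_vertex_def right_vertex_def inbox_def)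

lemma left_vertex_reflect:
  "left_vertex n (n - sx + \<alpha>) (n - sy - \<beta>) x y \<longleftrightarrow> right_vertex n sx sy \<alpha> \<beta> x y"
  by (auto simp: left_vertex_def right_vertex_def inbox_def)

text \<open>Since \<open>det(X, D) = 1\<close>, the vectors \<open>X\<close> and \<open>D\<close>
  form a basis of the lattice; the two brackets are the coordinates of
  \<open>(u, v)\<close>.\<close>

lemma lattice_decomp:
  fixes x y \<alpha> \<beta> u v :: int
  assumes "x * \<beta> - y * \<alpha> = 1"
  shows "u = (u * \<beta> + v * \<alpha>) * x - (u * y + v * x) * \<alpha>"
    and "v = - (u * \<beta> + v * \<alpha>) * y + (u * y + v * x) * \<beta>"
proof -
  have "u = u * (x * \<beta> - y * \<alpha>)" "v = v * (x * \<beta> - y * \<alpha>)" by (simp_all add: assms)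
  then show "u = (u * \<beta> + v * \<alpha>) * x - (u * y + v * x) * \<alpha>"
    "v = - (u * \<beta> + v * \<alpha>) * y + (u * y + v * x) * \<beta>" by (simp_all add: algebra_simps)
qed

text \<open>A point of the box at level \<open>c\<close> over the line through \<open>s\<close> and \<open>t\<close> spans with them a triangle
  whose slice at level one has length \<open>(c - 1) / c\<close> and end points of denominator \<open>c\<close>, hence
  contains a lattice point.\<close>

lemma level_one_point:
  assumes "inbox n sx sy" "inbox n (sx - \<alpha>) (sy + \<beta>)"
    and det: "x * \<beta> - y * \<alpha> = 1"
    and w: "inbox n wx wy" "(wx - sx) * \<beta> + (wy - sy) * \<alpha> = c" "c \<ge> 1"
  shows "\<exists>k. inbox n (sx + x - k * \<alpha>) (sy - y + k * \<beta>)"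
proof -
  define i where "i = (wx - sx) * y + (wy - sy) * x"
  have wx: "wx = sx + c * x - i * \<alpha>" and wy: "wy = sy - c * y + i * \<beta>"
    using lattice_decomp[OF det, where u = "wx - sx" and v = "wy - sy"] w(2) by (auto simp: i_def)
  \<comment> \<open>\<open>k\<close> is \<open>i / c\<close> rounded up, and \<open>r\<close> makes
    up the difference. Then \<open>s + X + k D\<close> is the convex combination of
    \<open>w\<close>, \<open>s\<close>, \<open>t\<close> with weights \<open>1\<close>,
    \<open>c - 1 - r\<close>, \<open>r\<close> over \<open>c\<close>.\<close>
  define r where "r = (- i) mod c"
  define k where "k = - ((- i) div c)"
  have r: "0 \<le> r" "r \<le> c - 1" using w(3) by (auto simp: r_def)
  have i: "i = c * k - r"
    using mult_div_mod_eq[of c "- i"] unfolding r_def k_def by linarith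
  have "inbox n (sx + x - k * \<alpha>) (sy - y + k * \<beta>)"
  proof (rule inbox_convex)
    show "c * (sx + x - k * \<alpha>) = wx + (c - 1 - r) * sx + r * (sx - \<alpha>)"
      "c * (sy - y + k * \<beta>) = wy + (c - 1 - r) * sy + r * (sy + \<beta>)"
      unfolding wx wy i by (simp_all add: algebra_simps)
  qed (use r assms in auto)
  then show ?thesis ..
qed

section \<open>Existence and uniqueness of the direction X\<close>

lemma exists_min_int:
  assumes "P (k::int)" "\<And>k. P k \<Longrightarrow> l \<le> k"
  obtains m where "P m" "\<not> P (m - 1)"
proof -
  have "\<exists>m. P m \<and> \<not> P (m - 1)"
  proof (rule ccontr)
    assume "\<nexists>m. P m \<and> \<not> P (m - 1)"
    then have step: "P (m - 1)" if "P m" for m using that by blast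
    have "P (k - int j)" for j
    proof (induction j)
      case (Suc j)
      then show ?case using step[of "k - int j"] by (simp add: algebra_simps)
    qed (use assms(1) in simp)
    then have "l \<le> k - int (nat (k - l + 1))" by (rule assms(2))
    then show False by (simp split: if_splits)
  qed
  then show thesis using that by blast
qed

text \<open>For \<open>y \<ge> 1\<close> the determinant forces \<open>x \<ge> 1\<close>. For
  \<open>y = 0\<close> it gives \<open>X = (1, 0)\<close> and \<open>\<beta> = 1\<close>, and the
  two blocked steps put \<open>s\<close> and \<open>t\<close> on opposite sides of the box. For
  \<open>y < 0\<close> each coordinate of \<open>s + X\<close> would lie between those of
  \<open>s\<close> and \<open>t + X\<close>, so \<open>s + X\<close> would be in the box.\<close>

lemma exists_side_dir_right:
  assumes c: "corner n sx sy \<alpha> \<beta>" and n: "n \<ge> 1"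
    and det: "x * \<beta> - y * \<alpha> = 1"
    and no: "\<not> inbox n (sx + x) (sy - y)" "\<not> inbox n (sx - \<alpha> - x) (sy + \<beta> + y)"
    and yes: "inbox n (sx - \<alpha> + x) (sy + \<beta> - y)"
  shows "(1 \<le> x \<and> 1 \<le> y) \<or> (sx = n \<and> \<alpha> = n \<and> \<beta> = 1)"
proof -
  have c': "0 \<le> \<alpha>" "1 \<le> \<beta>" using c by (auto simp: corner_def)
  consider "y \<ge> 1" | "y = 0" | "y \<le> -1" "x \<ge> 1" | "y \<le> -1" "x \<le> 0" by linarith
  then show ?thesis
  proof cases
    case 1
    have "y * \<alpha> \<ge> 0" using 1 c' by simp
    then have "x * \<beta> > 0" using det by linarith
    then show ?thesis using 1 c' by (simp add: zero_less_mult_iff)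
  next
    case 2
    then have "x * \<beta> = 1" using det by simp
    then have "x = 1" "\<beta> = 1" using c' by (auto simp: zmult_eq_1_iff)
    then show ?thesis using 2 no yes c n by (auto simp: corner_def inbox_def)
  next
    case 3
    have "x * \<beta> + (- y) * \<alpha> = 1" using det by simp
    moreover have "x * \<beta> \<ge> 1" using 3 c' mult_mono[of 1 x 1 \<beta>] by simp
    moreover have "(- y) * \<alpha> \<ge> \<alpha>" using 3 c' mult_right_mono[of 1 "-y" \<alpha>] by simp
    ultimately have "\<alpha> = 0" using c' by linarith
    then have "x * \<beta> = 1" using det by simp
    then have "x = 1" "\<beta> = 1" using c' by (auto simp: zmult_eq_1_iff)
    then show ?thesis using 3 no yes c n \<open>\<alpha> = 0\<close> by (auto simp: corner_def inbox_def)
  next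
    case 4
    then show ?thesis using no yes c n by (auto simp: corner_def inbox_def)
  qed
qed

text \<open>The solutions of \<open>det(X, D) = 1\<close> form a sequence with difference
  \<open>D\<close>. The direction wanted is the one just before the first \<open>X\<close> for which
  \<open>s + X\<close> or \<open>t - X\<close> enters the box.\<close>

lemma exists_side_dir:
  assumes c: "corner n sx sy \<alpha> \<beta>" and n: "n \<ge> 1" and nonspecial: "\<not> (\<alpha> = n \<and> \<beta> = 1)"
  obtains x y where "side_dir n sx sy \<alpha> \<beta> x y"
    "right_vertex n sx sy \<alpha> \<beta> x y \<or> left_vertex n sx sy x y"
proof -
  have c': "0 \<le> \<alpha>" "1 \<le> \<beta>" "inbox n sx sy" "inbox n (sx - \<alpha>) (sy + \<beta>)"
    using c by (auto simp: corner_def)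
  have "gcd \<beta> \<alpha> = 1" using c by (simp add: corner_def coprime_iff_gcd_eq_1 gcd.commute)
  then obtain u v where "u * \<beta> + v * \<alpha> = 1" using bezout_int[of \<beta> \<alpha>] by auto
  then obtain x0 y0 where det0: "x0 * \<beta> - y0 * \<alpha> = 1"
    by (metis diff_minus_eq_add mult_minus_left)
  define P where "P k \<longleftrightarrow> inbox n (sx + x0 - k * \<alpha>) (sy - y0 + k * \<beta>) \<or>
     inbox n (sx - \<alpha> - x0 + k * \<alpha>) (sy + \<beta> + y0 - k * \<beta>)" for k
  have "\<exists>k. P k"
  proof -
    \<comment> \<open>A box point off the line through \<open>s\<close> and \<open>t\<close>: the
      origin, unless that line passes through it. Then the line is the left side of the box and the
      opposite side helps.\<close>
    have lev: "\<exists>wx wy. inbox n wx wy \<and> (wx - sx) * \<beta> + (wy - sy) * \<alpha> \<noteq> 0"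
    proof (cases "sx * \<beta> + sy * \<alpha> = 0")
      case True
      then have "sx * \<beta> = 0" "sy * \<alpha> = 0"
        using c' by (simp_all add: inbox_def add_nonneg_eq_0_iff)
      then have "sx = 0" using c' by simp
      then have "\<alpha> = 0" using c' by (simp add: inbox_def)
      then show ?thesis using \<open>sx = 0\<close> n c' by (intro exI[of _ n]) (auto simp: inbox_def)
    next
      case False
      then show ?thesis using n by (intro exI[of _ 0]) (auto simp: inbox_def)
    qed
    then obtain wx wy where w: "inbox n wx wy" "(wx - sx) * \<beta> + (wy - sy) * \<alpha> \<noteq> 0" by blast
    show ?thesis
    proof (cases "(wx - sx) * \<beta> + (wy - sy) * \<alpha> \<ge> 1")
      case True
      then show ?thesis using level_one_point[OF c'(3,4) det0 w(1)] by (auto simp: P_def)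
    next
      case False
      have "\<exists>k. inbox n (n - sx + \<alpha> + x0 - k * \<alpha>) (n - sy - \<beta> - y0 + k * \<beta>)"
      proof (rule level_one_point[OF _ _ det0])
        show "inbox n (n - wx) (n - wy)" using w by (simp add: inbox_reflect)
        have "((n - wx) - (n - sx + \<alpha>)) * \<beta> + ((n - wy) - (n - sy - \<beta>)) * \<alpha> =
          - ((wx - sx) * \<beta> + (wy - sy) * \<alpha>)" by (simp add: algebra_simps)
        then show "((n - wx) - (n - sx + \<alpha>)) * \<beta> + ((n - wy) - (n - sy - \<beta>)) * \<alpha> \<ge> 1"
          using False w by linarith
      qed (use c' in \<open>auto simp: inbox_def\<close>)
      then obtain k where "inbox n (n - (sx - \<alpha> - x0 + k * \<alpha>)) (n - (sy + \<beta> + y0 - k * \<beta>))"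
        by (auto simp: algebra_simps)
      then show ?thesis unfolding inbox_reflect P_def by blast
    qed
  qed
  \<comment> \<open>As \<open>\<beta> \<ge> 1\<close>, a very negative \<open>k\<close> pushes both
    points out of the box vertically, so a minimal \<open>k\<close> exists.\<close>
  moreover have "- \<bar>y0\<bar> - n \<le> k" if "P k" for k
  proof (rule ccontr)
    assume k: "\<not> - \<bar>y0\<bar> - n \<le> k"
    then have "k * \<beta> \<le> k" using c' n mult_left_mono_neg[of 1 \<beta> k] by simp
    then show False using k that c' n by (auto simp: P_def inbox_def)
  qed
  ultimately obtain m where m: "P m" "\<not> P (m - 1)" using exists_min_int by metis
  \<comment> \<open>With the index \<open>m - 1\<close>, failure of \<open>P (m - 1)\<close>
    excludes \<open>s + X\<close> and \<open>t - X\<close>, while \<open>P m\<close> speaks of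
    \<open>s + X + D = t + X\<close> and \<open>t - X - D = s - X\<close>.\<close>
  define x y where "x = x0 - (m - 1) * \<alpha>" and "y = y0 - (m - 1) * \<beta>"
  have det: "x * \<beta> - y * \<alpha> = 1" using det0 by (simp add: x_def y_def algebra_simps)
  have no: "\<not> inbox n (sx + x) (sy - y)" "\<not> inbox n (sx - \<alpha> - x) (sy + \<beta> + y)"
    using m(2) by (auto simp: P_def x_def y_def algebra_simps)
  have yes: "inbox n (sx - \<alpha> + x) (sy + \<beta> - y) \<or> inbox n (sx - x) (sy + y)"
    using m(1) by (auto simp: P_def x_def y_def algebra_simps)
  have "1 \<le> x \<and> 1 \<le> y"
    using yes
  proof
    assume "inbox n (sx - \<alpha> + x) (sy + \<beta> - y)"
    then show ?thesis using exists_side_dir_right[OF c n det no] nonspecial by auto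
  next
    assume yes: "inbox n (sx - x) (sy + y)"
    have "(1 \<le> x \<and> 1 \<le> y) \<or> (n - sx + \<alpha> = n \<and> \<alpha> = n \<and> \<beta> = 1)"
      by (rule exists_side_dir_right[OF corner_reflect[THEN iffD2, OF c] n det])
        (use no yes in \<open>auto simp: inbox_def\<close>)
    then show ?thesis using nonspecial by auto
  qed
  then show thesis using that[of x y] det no yes
    by (auto simp: side_dir_def right_vertex_def left_vertex_def)
qed

text \<open>Here \<open>x = y * n + 1\<close> exceeds the width of the box. These are the corners of
  the triangles hanging from the top side.\<close>

lemma no_side_vertex_special:
  assumes "corner n sx sy n 1" "side_dir n sx sy n 1 x y"
  shows "\<not> right_vertex n sx sy n 1 x y" "\<not> left_vertex n sx sy x y"
proof -
  have "y * n \<ge> n" using assms by (simp add: corner_def side_dir_def mult_le_cancel_right1)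
  moreover have "x = y * n + 1" using assms by (simp add: side_dir_def)
  ultimately have "x > n" "sx = n" using assms by (auto simp: corner_def inbox_def)
  then show "\<not> right_vertex n sx sy n 1 x y" "\<not> left_vertex n sx sy x y"
    by (auto simp: right_vertex_def left_vertex_def inbox_def)
qed

text \<open>Now \<open>X = X' - m D\<close>. If \<open>t + X\<close> is in the box, each coordinate
  of \<open>s + X'\<close> lies between those of \<open>s\<close> and \<open>t + X\<close>, so
  \<open>s + X'\<close> is in the box as well; likewise for \<open>s - X\<close> and
  \<open>t - X'\<close>.\<close>

lemma side_dir_unique_aux:
  assumes c: "corner n sx sy \<alpha> \<beta>"
    and d: "side_dir n sx sy \<alpha> \<beta> x y" "side_dir n sx sy \<alpha> \<beta> x' y'"
    and v: "right_vertex n sx sy \<alpha> \<beta> x y \<or> left_vertex n sx sy x y"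
    and m: "x = x' + m * \<alpha>" "y = y' + m * \<beta>" "m \<ge> 1"
  shows False
proof -
  have ab: "0 \<le> \<alpha>" "1 \<le> \<beta>" using c by (auto simp: corner_def)
  obtain p q where pq: "p = m * \<alpha>" "q = m * \<beta>" "\<alpha> \<le> p" "\<beta> \<le> q"
    using ab m(3) by (simp add: mult_le_cancel_right1)
  moreover have "1 \<le> x'" "1 \<le> y'" "\<not> inbox n (sx + x') (sy - y')"
    "\<not> inbox n (sx - \<alpha> - x') (sy + \<beta> + y')" "inbox n sx sy" "inbox n (sx - \<alpha>) (sy + \<beta>)"
    using c d by (auto simp: corner_def side_dir_def)
  ultimately show False
    using v ab pq(3,4) unfolding m(1,2) pq(1,2)[symmetric] right_vertex_def left_vertex_def
    by (elim disjE) (auto simp: inbox_def)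
qed

lemma side_dir_unique:
  assumes c: "corner n sx sy \<alpha> \<beta>"
    and d: "side_dir n sx sy \<alpha> \<beta> x y" "side_dir n sx sy \<alpha> \<beta> x' y'"
    and v: "right_vertex n sx sy \<alpha> \<beta> x y \<or> left_vertex n sx sy x y"
      "right_vertex n sx sy \<alpha> \<beta> x' y' \<or> left_vertex n sx sy x' y'"
  shows "x = x' \<and> y = y'"
proof -
  define m where "m = (x' - x) * y + (y - y') * x"
  have det: "x * \<beta> - y * \<alpha> = 1" "x' * \<beta> - y' * \<alpha> = 1" using d by (auto simp: side_dir_def)
  have "x' - x = - m * \<alpha>" "y' - y = - m * \<beta>"
  proof -
    have z: "(x' - x) * \<beta> + (y - y') * \<alpha> = 0" using det by (simp add: algebra_simps)
    show "x' - x = - m * \<alpha>" "y' - y = - m * \<beta>"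
      using lattice_decomp[OF det(1), where u = "x' - x" and v = "y - y'"] unfolding z m_def[symmetric] by simp_all
  qed
  then have m: "x = x' + m * \<alpha>" "y = y' + m * \<beta>" "x' = x + - m * \<alpha>" "y' = y + - m * \<beta>"
    by auto
  have "\<not> m \<ge> 1" "\<not> - m \<ge> 1"
    using side_dir_unique_aux[OF c d v(1) m(1,2)] side_dir_unique_aux[OF c d(2,1) v(2) m(3,4)] by auto
  then have "m = 0" by linarith
  then show ?thesis using m by simp
qed

text \<open>\<open>A = 0\<close> or \<open>B = 0\<close> encodes a missing vertex on that side; the
  corresponding chord then falls back to \<open>t\<close> or \<open>s\<close>. So triangles and
  quadrilaterals obey the same formulas.\<close>

definition side_extent :: "int \<Rightarrow> int \<Rightarrow> int \<Rightarrow> int \<Rightarrow> int \<Rightarrow> int \<Rightarrow> int \<Rightarrow> int \<Rightarrow> int \<Rightarrow> bool" where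
  "side_extent n sx sy \<alpha> \<beta> x y A B \<longleftrightarrow> corner n sx sy \<alpha> \<beta> \<and> side_dir n sx sy \<alpha> \<beta> x y \<and>
     0 \<le> A \<and> 0 \<le> B \<and> 1 \<le> A + B \<and>
     inbox n (sx - \<alpha> + A * x) (sy + \<beta> - A * y) \<and>
     \<not> inbox n (sx - \<alpha> + (A + 1) * x) (sy + \<beta> - (A + 1) * y) \<and>
     inbox n (sx - B * x) (sy + B * y) \<and> \<not> inbox n (sx - (B + 1) * x) (sy + (B + 1) * y)"

lemma side_extent_reflect:
  "side_extent n (n - sx + \<alpha>) (n - sy - \<beta>) \<alpha> \<beta> x y B A \<longleftrightarrow> side_extent n sx sy \<alpha> \<beta> x y A B"
proof -
  have "inbox n (n - sx + \<alpha> - \<alpha> + k * x) (n - sy - \<beta> + \<beta> - k * y) \<longleftrightarrow> inbox n (sx - k * x) (sy + k * y)"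
    "inbox n (n - sx + \<alpha> - k * x) (n - sy - \<beta> + k * y) \<longleftrightarrow> inbox n (sx - \<alpha> + k * x) (sy + \<beta> - k * y)"
    for k
  proof -
    have "n - sx + \<alpha> - \<alpha> + k * x = n - (sx - k * x)" "n - sy - \<beta> + \<beta> - k * y = n - (sy + k * y)"
      "n - sx + \<alpha> - k * x = n - (sx - \<alpha> + k * x)" "n - sy - \<beta> + k * y = n - (sy + \<beta> - k * y)"
      by simp_all
    then show "inbox n (n - sx + \<alpha> - \<alpha> + k * x) (n - sy - \<beta> + \<beta> - k * y) \<longleftrightarrow> inbox n (sx - k * x) (sy + k * y)"
      "inbox n (n - sx + \<alpha> - k * x) (n - sy - \<beta> + k * y) \<longleftrightarrow> inbox n (sx - \<alpha> + k * x) (sy + \<beta> - k * y)"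
      by (simp_all only: inbox_reflect)
  qed
  note * = this
  show ?thesis
    unfolding side_extent_def corner_reflect side_dir_reflect *
    by (intro iffI; elim conjE; intro conjI; (assumption | simp add: add.commute))
qed

lemma exists_max_step:
  assumes "inbox n a b" "1 \<le> x"
  obtains A where "0 \<le> A" "inbox n (a + A * x) (b - A * y)"
    "\<not> inbox n (a + (A + 1) * x) (b - (A + 1) * y)" "A \<ge> 1 \<longleftrightarrow> inbox n (a + x) (b - y)"
proof -
  \<comment> \<open>The number of steps is negated so that the largest one comes from the minimum
    principle.\<close>
  define P where "P k \<longleftrightarrow> k \<le> 0 \<and> inbox n (a + (- k) * x) (b - (- k) * y)" for k
  have "- n \<le> k" if "P k" for k
  proof -
    have "- k \<le> (- k) * x" using that assms mult_left_mono[of 1 x "- k"] by (simp add: P_def)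
    then show ?thesis using that assms(1) by (auto simp: P_def inbox_def)
  qed
  then obtain m where m: "P m" "\<not> P (m - 1)"
    using exists_min_int[of P 0 "- n"] assms(1) by (auto simp: P_def)
  define A where "A = - m"
  have A: "0 \<le> A" "inbox n (a + A * x) (b - A * y)"
    "\<not> inbox n (a + (A + 1) * x) (b - (A + 1) * y)"
    using m by (auto simp: P_def A_def algebra_simps)
  moreover have "A \<ge> 1 \<longleftrightarrow> inbox n (a + x) (b - y)"
  proof
    assume "A \<ge> 1"
    then show "inbox n (a + x) (b - y)"
      by (intro inbox_convex[where c = A and p = "A - 1" and q = 0, OF _ _ _ _ _ A(2) assms(1) assms(1)])
        (simp_all add: algebra_simps)
  next
    assume "inbox n (a + x) (b - y)"
    then have "A \<noteq> 0" using A(3) by (metis add_0 mult_1)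
    then show "A \<ge> 1" using A(1) by linarith
  qed
  ultimately show thesis using that by blast
qed

lemma exists_side_extent:
  assumes c: "corner n sx sy \<alpha> \<beta>" and d: "side_dir n sx sy \<alpha> \<beta> x y"
    and v: "right_vertex n sx sy \<alpha> \<beta> x y \<or> left_vertex n sx sy x y"
  obtains A B where "side_extent n sx sy \<alpha> \<beta> x y A B"
    "A \<ge> 1 \<longleftrightarrow> right_vertex n sx sy \<alpha> \<beta> x y" "B \<ge> 1 \<longleftrightarrow> left_vertex n sx sy x y"
proof -
  have x: "1 \<le> x" using d by (simp add: side_dir_def)
  have st: "inbox n (sx - \<alpha>) (sy + \<beta>)" "inbox n (n - sx) (n - sy)"
    using c by (auto simp: corner_def inbox_reflect)
  from exists_max_step[OF st(1) x, of y] obtain A where A: "0 \<le> A"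
    "inbox n (sx - \<alpha> + A * x) (sy + \<beta> - A * y)"
    "\<not> inbox n (sx - \<alpha> + (A + 1) * x) (sy + \<beta> - (A + 1) * y)"
    "A \<ge> 1 \<longleftrightarrow> right_vertex n sx sy \<alpha> \<beta> x y" unfolding right_vertex_def by blast
  from exists_max_step[OF st(2) x, of y] obtain B where B: "0 \<le> B"
    "inbox n (n - sx + B * x) (n - sy - B * y)"
    "\<not> inbox n (n - sx + (B + 1) * x) (n - sy - (B + 1) * y)"
    "B \<ge> 1 \<longleftrightarrow> inbox n (n - sx + x) (n - sy - y)" by blast
  have B': "inbox n (sx - B * x) (sy + B * y)" "\<not> inbox n (sx - (B + 1) * x) (sy + (B + 1) * y)"
    "B \<ge> 1 \<longleftrightarrow> left_vertex n sx sy x y"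
    using B(2-4) by (auto simp: inbox_def left_vertex_def)
  show thesis
    using that[of A B] A B(1) B' c d v by (auto simp: side_extent_def)
qed

text \<open>Redundancy of all chords other than the sides: \<open>a + B \<le> i (A + B)\<close> makes the chord
  \<open>s + a X + i D\<close> a consequence of \<open>s\<close>, \<open>t + A X\<close> and \<open>s - B X\<close>.\<close>

lemma side_extent_positive:
  assumes e: "side_extent n sx sy \<alpha> \<beta> x y A B" and a: "a \<ge> 1"
    and w: "inbox n (sx + a * x - i * \<alpha>) (sy - a * y + i * \<beta>)"
  shows "i \<ge> 1" "a + B \<le> i * (A + B)"
proof -
  have c: "0 \<le> \<alpha>" "1 \<le> \<beta>" "inbox n sx sy" "inbox n (sx - \<alpha>) (sy + \<beta>)"
    and d: "1 \<le> x" "1 \<le> y" "x * \<beta> - y * \<alpha> = 1"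
    "\<not> inbox n (sx + x) (sy - y)" "\<not> inbox n (sx - \<alpha> - x) (sy + \<beta> + y)"
    and AB: "0 \<le> A" "0 \<le> B" "1 \<le> A + B"
    "inbox n (sx - \<alpha> + A * x) (sy + \<beta> - A * y)"
    "\<not> inbox n (sx - \<alpha> + (A + 1) * x) (sy + \<beta> - (A + 1) * y)"
    "inbox n (sx - B * x) (sy + B * y)" "\<not> inbox n (sx - (B + 1) * x) (sy + (B + 1) * y)"
    using e by (auto simp: side_extent_def corner_def side_dir_def)
  \<comment> \<open>For \<open>i \<le> 0\<close> the given point is at least as far right and at
    least as low as \<open>s + X\<close>, which would then be in the box.\<close>
  show i: "i \<ge> 1"
  proof (rule ccontr)
    assume "\<not> i \<ge> 1"
    then have "i * \<alpha> \<le> 0" "i * \<beta> \<le> 0" using c by (simp_all add: mult_nonpos_nonneg)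
    moreover have "x \<le> a * x" "y \<le> a * y" using a d by (simp_all add: mult_le_cancel_right1)
    ultimately show False using w c d(1,2,4) unfolding inbox_def by (smt (verit))
  qed
  show "a + B \<le> i * (A + B)"
  proof (rule ccontr)
    assume "\<not> a + B \<le> i * (A + B)"
    then have *: "a + B \<ge> i * A + i * B + 1" by (simp add: algebra_simps)
    show False
    proof (cases "B = 0")
      case False
      \<comment> \<open>Then \<open>t + (A + 1) X\<close> is the convex combination of the given
        point, \<open>t + A X\<close> and \<open>s\<close> with weights \<open>1\<close>,
        \<open>c' - i\<close>, \<open>i - 1\<close> over \<open>c'\<close>, contradicting the choice
        of \<open>A\<close>.\<close>
      define c' where "c' = a - i * A"
      have "(i - 1) * B \<ge> i - 1" using i AB False by (simp add: mult_le_cancel_left1)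
      then have ci: "c' \<ge> i" using * by (simp add: c'_def algebra_simps)
      have "inbox n (sx - \<alpha> + (A + 1) * x) (sy + \<beta> - (A + 1) * y)"
      proof (rule inbox_convex[OF _ _ _ _ _ w AB(4) c(3)])
        have a': "a = c' + i * A" by (simp add: c'_def)
        show "c' * (sx - \<alpha> + (A + 1) * x) = sx + a * x - i * \<alpha> + (c' - i) * (sx - \<alpha> + A * x) + (i - 1) * sx"
          "c' * (sy + \<beta> - (A + 1) * y) = sy - a * y + i * \<beta> + (c' - i) * (sy + \<beta> - A * y) + (i - 1) * sy"
          unfolding a' by (simp_all add: algebra_simps)
      qed (use ci i in auto)
      then show False using AB by simp
    next
      case True
      then have A: "A \<ge> 1" and a: "a \<ge> i * A + 1" and nB: "\<not> inbox n (sx - x) (sy + y)"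
        using AB * by auto
      have dA: "x \<le> A * x" "y \<le> A * y" using A d by (simp_all add: mult_le_cancel_right1)
      \<comment> \<open>Leaving the box in direction \<open>X\<close> through either side makes \<open>D\<close> long, leaving it in
        direction \<open>-X\<close> makes \<open>D\<close> short.\<close>
      have or1: "A * y < \<beta> \<or> A * x < \<alpha>"
      proof -
        have "(i * A) * y \<le> (a - 1) * y" "(i * A) * x \<le> (a - 1) * x"
          using a d by (simp_all add: mult_right_mono)
        then have m: "i * (A * y) \<le> a * y - y" "i * (A * x) \<le> a * x - x"
          by (simp_all add: algebra_simps)
        have "sy < y \<or> sx + x > n"
          using d(1,2,4) c by (auto simp: inbox_def)
        then show ?thesis
        proof
          assume "sy < y"
          then have "i * (A * y) < i * \<beta>" using m w by (auto simp: inbox_def)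
          then show ?thesis using i by simp
        next
          assume "sx + x > n"
          then have "i * (A * x) < i * \<alpha>" using m w by (auto simp: inbox_def)
          then show ?thesis using i by simp
        qed
      qed
      have or2: "\<beta> < y \<or> \<alpha> < x"
        using nB c d(1,2) by (auto simp: inbox_def)
      have det: "x * \<beta> = y * \<alpha> + 1" using d by simp
      have "\<alpha> < A * x" if "\<alpha> < x" using that dA by linarith
      moreover have "\<beta> < A * y" if "\<beta> < y" using that dA by linarith
      ultimately consider "A * y < \<beta>" "\<alpha> < x" | "A * x < \<alpha>" "\<beta> < y"
        using or1 or2 by linarith
      \<comment> \<open>Either way \<open>D\<close> is beyond \<open>X\<close> in one coordinate and
        short of it in the other, so the determinant cannot be 1: the first case gives
        \<open>x + y \<le> 1\<close>, the second \<open>x + y \<le> -1\<close>.\<close>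
      then show False
      proof cases
        case 1
        have "x * (y + 1) \<le> x * \<beta>" "y * (\<alpha> + 1) \<le> y * x"
          using 1 dA(2) d(1,2) by (intro mult_left_mono; linarith)+
        then show False using det d by (simp add: algebra_simps)
      next
        case 2
        have "x * (\<beta> + 1) \<le> x * y" "y * (x + 1) \<le> y * \<alpha>"
          using 2 dA(1) d(1,2) by (intro mult_left_mono; linarith)+
        then show False using det d by (simp add: algebra_simps)
      qed
    qed
  qed
qed

text \<open>The half turn exchanges \<open>A\<close> with \<open>B\<close>, level \<open>-a\<close>
  with level \<open>a\<close>, and \<open>i\<close> with \<open>1 - i\<close>.\<close>

lemma side_extent_negative:
  assumes e: "side_extent n sx sy \<alpha> \<beta> x y A B" and a: "a \<ge> 1"
    and w: "inbox n (sx - a * x - i * \<alpha>) (sy + a * y + i * \<beta>)"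
  shows "i \<le> 0" "a + A \<le> (1 - i) * (A + B)"
proof -
  have "inbox n (n - sx + \<alpha> + a * x - (1 - i) * \<alpha>) (n - sy - \<beta> - a * y + (1 - i) * \<beta>)"
    using w by (auto simp: inbox_def algebra_simps)
  from side_extent_positive[OF side_extent_reflect[THEN iffD2, OF e] a this]
  show "i \<le> 0" "a + A \<le> (1 - i) * (A + B)"
    by (auto simp: add.commute)
qed

text \<open>Serves to show that the region cut out by the sides stays below the top of the
  rectangle. One end can be passed within \<open>A + B\<close> steps: \<open>t + (A + 1) X\<close>
  if \<open>A = 0\<close>, otherwise \<open>s - (B + 1) X\<close>. The box then bounds
  \<open>\<beta>\<close> or \<open>\<alpha>\<close>, and the determinant turns the second bound into
  the first.\<close>

lemma side_extent_top:
  assumes e: "side_extent n sx sy \<alpha> \<beta> x y A B"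
  shows "\<beta> \<le> (A + B) * y"
proof -
  have d: "1 \<le> x" "1 \<le> y" "x * \<beta> = y * \<alpha> + 1"
    using e by (auto simp: side_extent_def side_dir_def)
  have "\<beta> \<le> (A + B) * y \<or> \<alpha> < (A + B) * x"
  proof -
    define ax ay bx bY where ext: "ax = (A + 1) * x" "ay = (A + 1) * y" "bx = (B + 1) * x" "bY = (B + 1) * y"
    have AB: "0 \<le> A" "0 \<le> B" "1 \<le> A + B" using e by (auto simp: side_extent_def)
    have pos: "0 \<le> ax" "0 \<le> ay" "0 \<le> bx" "0 \<le> bY" using AB d by (simp_all add: ext)
    have in_st: "inbox n sx sy" "inbox n (sx - \<alpha>) (sy + \<beta>)" "0 \<le> \<alpha>" "1 \<le> \<beta>"
      and out: "\<not> inbox n (sx - \<alpha> + ax) (sy + \<beta> - ay)" "\<not> inbox n (sx - bx) (sy + bY)"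
      using e by (auto simp: side_extent_def corner_def ext)
    show ?thesis
    proof (cases "A \<ge> 1")
      case True
      then have "bx \<le> (A + B) * x" "bY \<le> (A + B) * y"
        using d unfolding ext by (intro mult_right_mono; simp)+
      then show ?thesis using in_st out(2) pos by (auto simp: inbox_def)
    next
      case False
      then have "ax \<le> (A + B) * x" "ay \<le> (A + B) * y"
        using d AB unfolding ext by (intro mult_right_mono; simp)+
      then show ?thesis using in_st out(1) pos by (auto simp: inbox_def)
    qed
  qed
  then show ?thesis
  proof
    assume "\<alpha> < (A + B) * x"
    then have "y * (\<alpha> + 1) \<le> y * ((A + B) * x)" using d by (intro mult_left_mono) auto
    then have "x * \<beta> \<le> x * ((A + B) * y)" using d by (simp add: algebra_simps)
    then show ?thesis using d(1) mult_left_le_imp_le[of x \<beta>] by simp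
  qed
qed

section \<open>Shapes of the cells\<close>

text \<open>The minus sign turns \<open>f p > 0\<close> into a half-plane
  \<open>(u, v) \<bullet> p < c\<close>, as in the polygon lemmas.\<close>

definition affine_fun :: "(real \<times> real \<Rightarrow> real) \<Rightarrow> bool" where
  "affine_fun f \<longleftrightarrow> (\<exists>c u v. \<forall>p. f p = c - (u, v) \<bullet> p)"

lemma affine_fun_intros:
  "affine_fun (chord_fun w)" "affine_fun (\<lambda>p. - chord_fun w p)" "affine_fun snd" "affine_fun (\<lambda>p. 1 - snd p)"
proof -
  have "chord_fun w p = of_int (fst w) - (1, of_int (fst w - snd w)) \<bullet> p"
    "- chord_fun w p = - of_int (fst w) - (-1, of_int (snd w - fst w)) \<bullet> p"
    "snd p = 0 - (0, -1) \<bullet> p" "1 - snd p = 1 - (0, 1) \<bullet> p" for p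
    by (auto simp: chord_fun_def inner_prod_def algebra_simps)
  then show "affine_fun (chord_fun w)" "affine_fun (\<lambda>p. - chord_fun w p)" "affine_fun snd"
    "affine_fun (\<lambda>p. 1 - snd p)" unfolding affine_fun_def by blast+
qed

lemma triangle_if_affine_funs:
  assumes "affine_fun f" "affine_fun g" "affine_fun h"
    and "C = {p. f p > 0 \<and> g p > 0 \<and> h p > 0}" "C \<noteq> {}" "bounded C"
    and "\<exists>w. f w < 0 \<and> g w > 0 \<and> h w > 0" "\<exists>w. f w > 0 \<and> g w < 0 \<and> h w > 0"
      "\<exists>w. f w > 0 \<and> g w > 0 \<and> h w < 0"
  shows "polygon_with_sides 3 C"
proof -
  obtain a1 b1 a2 b2 a3 b3 where fgh: "\<And>p. f p = b1 - a1 \<bullet> p" "\<And>p. g p = b2 - a2 \<bullet> p" "\<And>p. h p = b3 - a3 \<bullet> p"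
    using assms(1-3) unfolding affine_fun_def by blast
  show ?thesis
    by (rule polygon_with_three_sides[OF _ assms(5,6), of a1 b1 a2 b2 a3 b3])
      (use assms(4,7-9) in \<open>simp_all add: fgh del: split_paired_Ex\<close>)
qed

lemma quadrilateral_if_affine_funs:
  assumes "affine_fun f" "affine_fun g" "affine_fun h" "affine_fun k"
    and "C = {p. f p > 0 \<and> g p > 0 \<and> h p > 0 \<and> k p > 0}" "C \<noteq> {}" "bounded C"
    and "\<exists>w. f w < 0 \<and> g w > 0 \<and> h w > 0 \<and> k w > 0" "\<exists>w. f w > 0 \<and> g w < 0 \<and> h w > 0 \<and> k w > 0"
      "\<exists>w. f w > 0 \<and> g w > 0 \<and> h w < 0 \<and> k w > 0" "\<exists>w. f w > 0 \<and> g w > 0 \<and> h w > 0 \<and> k w < 0"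
  shows "polygon_with_sides 4 C"
proof -
  obtain a1 b1 a2 b2 a3 b3 a4 b4 where fgh: "\<And>p. f p = b1 - a1 \<bullet> p" "\<And>p. g p = b2 - a2 \<bullet> p"
    "\<And>p. h p = b3 - a3 \<bullet> p" "\<And>p. k p = b4 - a4 \<bullet> p"
    using assms(1-4) unfolding affine_fun_def by blast
  show ?thesis
    by (rule polygon_with_four_sides[OF _ assms(6,7), of a1 b1 a2 b2 a3 b3 a4 b4])
      (use assms(5,8-11) in \<open>simp_all add: fgh del: split_paired_Ex\<close>)
qed

section \<open>Cells above a lowest vertex\<close>

lemma mem_grid: "(a, b) \<in> grid n \<longleftrightarrow> inbox (int n) a b"
  by (auto simp: grid_def inbox_def)

text \<open>The level \<open>(a - sx) * \<beta> + (b - sy) * \<alpha>\<close> vanishes exactly for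
  the chords through the crossing of \<open>s\<close> and \<open>t\<close>. Just above that point
  these chords are ordered from left to right by their upper ends, so those up to \<open>s\<close>
  are on the left.\<close>

definition corner_set :: "nat \<Rightarrow> int \<Rightarrow> int \<Rightarrow> int \<Rightarrow> int \<Rightarrow> (int \<times> int) set" where
  "corner_set n sx sy \<alpha> \<beta> = {(a, b) \<in> grid n. (a - sx) * \<beta> + (b - sy) * \<alpha> < 0 \<or>
     (a - sx) * \<beta> + (b - sy) * \<alpha> = 0 \<and> b \<le> sy}"

lemma mem_corner_set:
  "(a, b) \<in> corner_set n sx sy \<alpha> \<beta> \<longleftrightarrow> inbox (int n) a b \<and> ((a - sx) * \<beta> + (b - sy) * \<alpha> < 0 \<or>
     (a - sx) * \<beta> + (b - sy) * \<alpha> = 0 \<and> b \<le> sy)"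
  by (auto simp: corner_set_def mem_grid)

lemma corner_set_endpoints:
  assumes "corner (int n) sx sy \<alpha> \<beta>"
  shows "(sx, sy) \<in> corner_set n sx sy \<alpha> \<beta>" "(sx - \<alpha>, sy + \<beta>) \<notin> corner_set n sx sy \<alpha> \<beta>"
  using assms by (auto simp: mem_corner_set corner_def)

text \<open>Each set contains the \<open>s\<close> and omits the \<open>t\<close> of the other pair.
  Comparing levels both ways makes the two primitive directions equal; then both pairs lie on one
  line, where \<open>s\<close> is the last member.\<close>

lemma corner_set_inj:
  assumes c: "corner (int n) sx sy \<alpha> \<beta>" "corner (int n) sx' sy' \<alpha>' \<beta>'"
    and eq: "corner_set n sx sy \<alpha> \<beta> = corner_set n sx' sy' \<alpha>' \<beta>'"
  shows "sx = sx' \<and> sy = sy' \<and> \<alpha> = \<alpha>' \<and> \<beta> = \<beta>'"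
proof -
  have in1: "(sx', sy') \<in> corner_set n sx sy \<alpha> \<beta>" "(sx' - \<alpha>', sy' + \<beta>') \<notin> corner_set n sx sy \<alpha> \<beta>"
    and in2: "(sx, sy) \<in> corner_set n sx' sy' \<alpha>' \<beta>'" "(sx - \<alpha>, sy + \<beta>) \<notin> corner_set n sx' sy' \<alpha>' \<beta>'"
    using corner_set_endpoints[OF c(1)] corner_set_endpoints[OF c(2)] eq by auto
  have b: "inbox (int n) (sx' - \<alpha>') (sy' + \<beta>')" "inbox (int n) (sx - \<alpha>) (sy + \<beta>)"
    "1 \<le> \<beta>" "1 \<le> \<beta>'" "0 \<le> \<alpha>" "0 \<le> \<alpha>'" "coprime \<alpha> \<beta>" "coprime \<alpha>' \<beta>'"
    using c by (auto simp: corner_def)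
  have l1: "(sx' - sx) * \<beta> + (sy' - sy) * \<alpha> \<le> 0" "(sx' - \<alpha>' - sx) * \<beta> + (sy' + \<beta>' - sy) * \<alpha> \<ge> 0"
    using in1 b by (auto simp: mem_corner_set not_less)
  have l2: "(sx - sx') * \<beta>' + (sy - sy') * \<alpha>' \<le> 0" "(sx - \<alpha> - sx') * \<beta>' + (sy + \<beta> - sy') * \<alpha>' \<ge> 0"
    using in2 b by (auto simp: mem_corner_set not_less)
  have "\<alpha>' * \<beta> \<le> \<alpha> * \<beta>'" using l1 by (simp add: algebra_simps)
  moreover have "\<alpha> * \<beta>' \<le> \<alpha>' * \<beta>" using l2 by (simp add: algebra_simps)
  ultimately have cross: "\<alpha> * \<beta>' = \<alpha>' * \<beta>" by simp
  have ab: "\<alpha> = \<alpha>'" "\<beta> = \<beta>'"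
  proof -
    have "\<bar>\<alpha>\<bar> = \<bar>\<alpha>'\<bar> \<and> \<bar>\<beta>'\<bar> = \<bar>\<beta>\<bar>"
      using coprime_crossproduct_int[of \<alpha> \<beta> \<alpha>' \<beta>'] b(7,8) cross by (metis abs_mult)
    then show "\<alpha> = \<alpha>'" "\<beta> = \<beta>'" using b by auto
  qed
  have z: "(sx' - sx) * \<beta> + (sy' - sy) * \<alpha> = 0"
    using l1(1) l2(1) unfolding ab[symmetric] by (simp add: algebra_simps)
  moreover have "(sx - sx') * \<beta>' + (sy - sy') * \<alpha>' = 0"
    using z unfolding ab[symmetric] by (simp add: algebra_simps)
  ultimately have "sy = sy'" using in1(1) in2(1) by (simp add: mem_corner_set)
  then show ?thesis using z ab b by simp
qed

lemma chord_fun_lattice: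
  "chord_fun (sx + a * x - i * \<alpha>, sy - a * y + i * \<beta>) p = chord_fun (sx, sy) p +
    of_int a * (of_int x * (1 - snd p) - of_int y * snd p) +
    of_int i * (of_int \<beta> * snd p - of_int \<alpha> * (1 - snd p))"
  by (simp add: chord_fun_def algebra_simps)

text \<open>By \<open>chord_fun_lattice\<close> the chord \<open>s + a X + i D\<close> has the value
  \<open>f + a FX + i FD\<close> at \<open>p\<close>, where \<open>FX\<close> and \<open>FD\<close>
  are the increments along \<open>X\<close> and \<open>D\<close>. So every sign must follow from
  inequalities between \<open>f\<close>, \<open>FX\<close> and \<open>FD\<close>.\<close>

lemma cell_of_corner:
  assumes e: "side_extent (int n) sx sy \<alpha> \<beta> x y A B"
  shows "cell_of n (corner_set n sx sy \<alpha> \<beta>) =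
    {p. chord_fun (sx, sy) p < 0 \<and> chord_fun (sx - \<alpha>, sy + \<beta>) p > 0 \<and>
        chord_fun (sx - \<alpha> + A * x, sy + \<beta> - A * y) p > 0 \<and> chord_fun (sx - B * x, sy + B * y) p < 0}"
    (is "?L = ?R")
proof
  have c: "0 \<le> \<alpha>" "1 \<le> \<beta>" "inbox (int n) sx sy" "inbox (int n) (sx - \<alpha>) (sy + \<beta>)"
    and d: "1 \<le> x" "1 \<le> y" and det: "x * \<beta> - y * \<alpha> = 1"
    and AB: "0 \<le> A" "0 \<le> B" "1 \<le> A + B"
    "inbox (int n) (sx - \<alpha> + A * x) (sy + \<beta> - A * y)" "inbox (int n) (sx - B * x) (sy + B * y)"
    using e by (auto simp: side_extent_def corner_def side_dir_def)
  have lev: "(a * x - i * \<alpha>) * \<beta> + (- a * y + i * \<beta>) * \<alpha> = a" for a i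
  proof -
    have "(a * x - i * \<alpha>) * \<beta> + (- a * y + i * \<beta>) * \<alpha> = a * (x * \<beta> - y * \<alpha>)"
      by (simp add: algebra_simps)
    then show ?thesis using det by simp
  qed
  show "?L \<subseteq> ?R"
  proof
    fix p assume p: "p \<in> ?L"
    have neg: "chord_fun w p < 0" if "w \<in> corner_set n sx sy \<alpha> \<beta>" for w
      using p that by (auto simp: cell_of_def corner_set_def)
    have pos: "chord_fun w p > 0" if "w \<in> grid n" "w \<notin> corner_set n sx sy \<alpha> \<beta>" for w
      using p that by (auto simp: cell_of_def)
    have "(sx - B * x, sy + B * y) \<in> corner_set n sx sy \<alpha> \<beta>"
      using lev[of "- B" 0] AB by (cases "B = 0") (auto simp: mem_corner_set)
    moreover have "(sx - \<alpha> + A * x, sy + \<beta> - A * y) \<notin> corner_set n sx sy \<alpha> \<beta>"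
    proof -
      have "(sx - \<alpha> + A * x - sx) * \<beta> + (sy + \<beta> - A * y - sy) * \<alpha> = A"
        using lev[of A 1] by (simp add: algebra_simps)
      then show ?thesis using AB c by (cases "A = 0") (auto simp: mem_corner_set)
    qed
    ultimately show "p \<in> ?R"
      using neg pos AB c corner_set_endpoints[of n sx sy \<alpha> \<beta>] e
      by (auto simp: mem_grid side_extent_def)
  qed
  show "?R \<subseteq> ?L"
  proof
    fix p assume p: "p \<in> ?R"
    define f where "f = chord_fun (sx, sy) p"
    define FX where "FX = of_int x * (1 - snd p) - of_int y * snd p"
    define FD where "FD = of_int \<beta> * snd p - of_int \<alpha> * (1 - snd p)"
    have F: "chord_fun (sx + a * x - i * \<alpha>, sy - a * y + i * \<beta>) p = f + of_int a * FX + of_int i * FD" for a i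
      unfolding f_def FX_def FD_def by (rule chord_fun_lattice)
    have fneg: "f < 0" and ft: "f + FD > 0" and fA: "f + of_int A * FX + FD > 0" and fB: "f - of_int B * FX < 0"
      using p F[of 0 0] F[of 0 1] F[of A 1] F[of "- B" 0] by (auto simp: algebra_simps)
    have FD: "FD > 0" using fneg ft by simp
    have FXD: "of_int (A + B) * FX + FD > 0" using fA fB by (simp add: algebra_simps)
    have y0: "snd p > 0"
    proof (rule ccontr)
      assume "\<not> snd p > 0"
      then have "of_int \<beta> * snd p \<le> 0" "of_int \<alpha> * (1 - snd p) \<ge> 0"
        using c by (auto simp: mult_nonneg_nonpos)
      then show False using FD by (simp add: FD_def)
    qed
    \<comment> \<open>Expressing \<open>1 - snd p\<close> through \<open>FX\<close> and
      \<open>FD\<close> reduces the upper bound on \<open>p\<close> to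
      \<open>side_extent_top\<close>.\<close>
    have "1 - snd p = of_int (x * \<beta> - y * \<alpha>) * (1 - snd p)" by (simp add: det)
    also have "\<dots> = of_int y * FD + of_int \<beta> * FX" by (simp add: FX_def FD_def algebra_simps)
    finally have eq1: "1 - snd p = of_int y * FD + of_int \<beta> * FX" .
    have yFD: "of_int y * FD > 0" using d FD by simp
    have y1: "snd p < 1"
    proof (cases "FX \<ge> 0")
      case True
      then have "of_int \<beta> * FX \<ge> 0" using c by simp
      then show ?thesis using eq1 yFD by linarith
    next
      case False
      have "of_int \<beta> \<le> (of_int ((A + B) * y) :: real)"
        using side_extent_top[OF e] by (simp only: of_int_le_iff)
      then have "of_int ((A + B) * y) * FX \<le> of_int \<beta> * FX"
        using False by (intro mult_right_mono_neg) auto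
      moreover have "of_int y * (of_int (A + B) * FX + FD) > 0" using FXD d by simp
      ultimately show ?thesis using eq1 by (simp add: algebra_simps)
    qed
    have main: "(w \<in> corner_set n sx sy \<alpha> \<beta> \<longrightarrow> chord_fun w p < 0) \<and>
       (w \<notin> corner_set n sx sy \<alpha> \<beta> \<longrightarrow> chord_fun w p > 0)" if w: "w \<in> grid n" for w
    proof -
      obtain wx wy where wxy: "w = (wx, wy)" by force
      define a i where "a = (wx - sx) * \<beta> + (wy - sy) * \<alpha>" and "i = (wx - sx) * y + (wy - sy) * x"
      have wx: "wx = sx + a * x - i * \<alpha>" and wy: "wy = sy - a * y + i * \<beta>"
        using lattice_decomp[OF det, where u = "wx - sx" and v = "wy - sy"]
        unfolding a_def[symmetric] i_def[symmetric] by auto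
      have inb: "inbox (int n) (sx + a * x - i * \<alpha>) (sy - a * y + i * \<beta>)"
        using w wxy wx wy by (simp add: mem_grid)
      have Fw: "chord_fun w p = f + of_int a * FX + of_int i * FD"
        unfolding wxy wx wy by (rule F)
      have mem: "w \<in> corner_set n sx sy \<alpha> \<beta> \<longleftrightarrow> a < 0 \<or> a = 0 \<and> wy \<le> sy"
        using w unfolding wxy by (simp add: mem_grid mem_corner_set a_def)
      consider "a \<ge> 1" | "a = 0" | "a \<le> -1" by linarith
      then show ?thesis
      proof cases
        case 1
        note i = side_extent_positive[OF e 1 inb]
        have "chord_fun w p > 0"
        \<comment> \<open>For \<open>FX \<ge> 0\<close> the value is at least that of
          \<open>t\<close>. For \<open>FX < 0\<close>, replacing \<open>a\<close> by its upper bound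
          \<open>i * (A + B) - B\<close> and then \<open>i\<close> by 1 bounds the value below by
          that of \<open>t + A X\<close>.\<close>
        proof (cases "FX \<ge> 0")
          case True
          then have "of_int a * FX \<ge> 0" "of_int i * FD \<ge> 1 * FD"
            using 1 i FD by (auto intro!: mult_right_mono)
          then show ?thesis using Fw ft by linarith
        next
          case False
          have "of_int a \<le> (of_int (i * (A + B) - B) :: real)"
            using i(2) by (simp only: of_int_le_iff)
          then have "of_int (i * (A + B) - B) * FX \<le> of_int a * FX"
            using False by (intro mult_right_mono_neg) auto
          moreover have "of_int i * (of_int (A + B) * FX + FD) \<ge> 1 * (of_int (A + B) * FX + FD)"
            using FXD i(1) by (intro mult_right_mono) auto
          ultimately show ?thesis using Fw fA by (simp add: algebra_simps)
        qed
        then show ?thesis using mem 1 by auto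
      next
        case 2
        then have "wy \<le> sy \<longleftrightarrow> i \<le> 0" using wy c by (simp add: mult_le_0_iff)
        moreover have "chord_fun w p < 0" if "i \<le> 0"
        proof -
          have "of_int i * FD \<le> 0" using that FD by (simp add: mult_nonpos_nonneg)
          then show ?thesis using Fw fneg 2 by simp
        qed
        moreover have "chord_fun w p > 0" if "\<not> i \<le> 0"
        proof -
          have "of_int i * FD \<ge> 1 * FD" using that FD by (intro mult_right_mono) auto
          then show ?thesis using Fw ft 2 by simp
        qed
        ultimately show ?thesis using mem 2 by auto
      next
        case 3
        have inb': "inbox (int n) (sx - (- a) * x - i * \<alpha>) (sy + (- a) * y + i * \<beta>)"
          using inb by simp
        have i: "i \<le> 0" "- a + A \<le> (1 - i) * (A + B)"
          using side_extent_negative[OF e _ inb'] 3 by auto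
        have "chord_fun w p < 0"
        \<comment> \<open>Symmetric: the value is at most that of \<open>s\<close> if
          \<open>FX \<ge> 0\<close>, and at most that of \<open>s - B X\<close> otherwise.\<close>
        proof (cases "FX \<ge> 0")
          case True
          then have "of_int a * FX \<le> 0" "of_int i * FD \<le> 0"
            using 3 i FD by (auto simp: mult_nonpos_nonneg)
          then show ?thesis using Fw fneg by linarith
        next
          case False
          have "of_int a \<ge> (of_int (A - (1 - i) * (A + B)) :: real)"
            using i(2) by (simp only: of_int_le_iff)
          then have "of_int a * FX \<le> of_int (A - (1 - i) * (A + B)) * FX"
            using False by (intro mult_right_mono_neg) auto
          moreover have "of_int (1 - i) * (of_int (A + B) * FX + FD) \<ge> 1 * (of_int (A + B) * FX + FD)"
            using FXD i(1) by (intro mult_right_mono) auto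
          ultimately show ?thesis using Fw fB by (simp add: algebra_simps)
        qed
        then show ?thesis using mem 3 by auto
      qed
    qed
    show "p \<in> ?L" using y0 y1 main by (simp add: cell_of_def)
  qed
qed

text \<open>In the projective coordinates \<open>(G, z)\<close> the chord \<open>s + aX + iD\<close> becomes the line \<open>aG + i = z\<close>.\<close>

lemma projective_point:
  fixes G z :: real
  assumes det: "x * \<beta> - y * \<alpha> = 1"
    and G: "of_int x + G * of_int \<alpha> > 0" "of_int y + G * of_int \<beta> > 0"
  obtains p where
    "\<And>a i. chord_fun (sx + a * x - i * \<alpha>, sy - a * y + i * \<beta>) p < 0 \<longleftrightarrow> of_int a * G + of_int i < z"
    "\<And>a i. chord_fun (sx + a * x - i * \<alpha>, sy - a * y + i * \<beta>) p > 0 \<longleftrightarrow> of_int a * G + of_int i > z"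
proof -
  define c where "c = of_int x + G * of_int \<alpha> + (of_int y + G * of_int \<beta>)"
  \<comment> \<open>The height at which the increments along \<open>X\<close> and \<open>D\<close>
    are \<open>G / c\<close> and \<open>1 / c\<close>; the first coordinate of \<open>p\<close> then
    gives the chord \<open>s\<close> the value \<open>- z / c\<close>.\<close>
  define \<eta> where "\<eta> = (of_int x + G * of_int \<alpha>) / c"
  define p where "p = (of_int sx * (1 - \<eta>) + of_int sy * \<eta> + z / c, \<eta>)"
  have c: "c > 0" using G by (simp add: c_def)
  have \<eta>': "1 - \<eta> = (of_int y + G * of_int \<beta>) / c"
    using c by (simp add: \<eta>_def field_simps) (simp add: c_def)
  have det': "of_int x * of_int \<beta> - of_int y * of_int \<alpha> = (1::real)"
    using det by (metis of_int_1 of_int_diff of_int_mult)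
  have "of_int x * (1 - \<eta>) - of_int y * \<eta> =
      (of_int x * (of_int y + G * of_int \<beta>) - of_int y * (of_int x + G * of_int \<alpha>)) / c"
    unfolding \<eta>' unfolding \<eta>_def by (simp add: diff_divide_distrib)
  also have "of_int x * (of_int y + G * of_int \<beta>) - of_int y * (of_int x + G * of_int \<alpha>) =
      G * (of_int x * of_int \<beta> - of_int y * of_int \<alpha>)"
    by (simp add: algebra_simps)
  finally have FX: "of_int x * (1 - \<eta>) - of_int y * \<eta> = G / c" using det' by simp
  have "of_int \<beta> * \<eta> - of_int \<alpha> * (1 - \<eta>) =
      (of_int \<beta> * (of_int x + G * of_int \<alpha>) - of_int \<alpha> * (of_int y + G * of_int \<beta>)) / c"
    unfolding \<eta>' unfolding \<eta>_def by (simp add: diff_divide_distrib)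
  also have "of_int \<beta> * (of_int x + G * of_int \<alpha>) - of_int \<alpha> * (of_int y + G * of_int \<beta>) =
      of_int x * of_int \<beta> - of_int y * of_int \<alpha>"
    by (simp add: algebra_simps)
  finally have FD: "of_int \<beta> * \<eta> - of_int \<alpha> * (1 - \<eta>) = 1 / c" using det' by simp
  have "chord_fun (sx + a * x - i * \<alpha>, sy - a * y + i * \<beta>) p = (of_int a * G + of_int i - z) / c" for a i
    unfolding chord_fun_lattice
    by (simp add: p_def FX FD) (simp add: chord_fun_def add_divide_distrib diff_divide_distrib)
  then show thesis using that[of p] c by (simp add: zero_less_divide_iff divide_less_0_iff)
qed

lemma bounded_cell_of:
  assumes "(0, 0) \<in> S" "(int n, int n) \<notin> S"
  shows "bounded (cell_of n S)"
proof (rule bounded_subset)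
  show "cell_of n S \<subseteq> BC_rect n"
  proof
    fix p assume p: "p \<in> cell_of n S"
    then have "0 < snd p" "snd p < 1" by (auto simp: cell_of_def)
    then show "p \<in> BC_rect n" using cell_of_subset_box[OF assms p] by (simp add: BC_rect_eq)
  qed
qed (simp add: BC_rect_def)

lemma corner_set_bounds:
  assumes "corner (int n) sx sy \<alpha> \<beta>"
  shows "corner_set n sx sy \<alpha> \<beta> \<subseteq> grid n" "(0, 0) \<in> corner_set n sx sy \<alpha> \<beta>"
    "(int n, int n) \<notin> corner_set n sx sy \<alpha> \<beta>"
proof -
  have c: "0 \<le> \<alpha>" "1 \<le> \<beta>" "inbox (int n) sx sy" "inbox (int n) (sx - \<alpha>) (sy + \<beta>)"
    using assms by (auto simp: corner_def)
  show "corner_set n sx sy \<alpha> \<beta> \<subseteq> grid n" by (auto simp: corner_set_def)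
  have "(0 - sx) * \<beta> + (0 - sy) * \<alpha> \<le> 0" "(int n - sx) * \<beta> + (int n - sy) * \<alpha> \<ge> 0"
    using c by (auto simp only: inbox_def
        intro!: add_nonpos_nonpos mult_nonpos_nonneg add_nonneg_nonneg mult_nonneg_nonneg)
  then show "(0, 0) \<in> corner_set n sx sy \<alpha> \<beta>" "(int n, int n) \<notin> corner_set n sx sy \<alpha> \<beta>"
    using c unfolding mem_corner_set inbox_def by linarith+
qed

text \<open>In the coordinates of \<open>projective_point\<close> the cell is
  \<open>0 < z < 1\<close>, \<open>- B G < z < A G + 1\<close>. The last two bounds cut only where
  \<open>G < 0\<close>, so \<open>s\<close> and \<open>t\<close> are violated alone at positive
  \<open>G\<close>, the other sides at a small negative \<open>G\<close>.\<close>

lemma polygon_corner: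
  assumes e: "side_extent (int n) sx sy \<alpha> \<beta> x y A B"
  shows "cell_of n (corner_set n sx sy \<alpha> \<beta>) \<noteq> {}"
    "polygon_with_sides (if A \<ge> 1 \<and> B \<ge> 1 then 4 else 3) (cell_of n (corner_set n sx sy \<alpha> \<beta>))"
proof -
  let ?C = "cell_of n (corner_set n sx sy \<alpha> \<beta>)"
  have corner: "corner (int n) sx sy \<alpha> \<beta>" and c: "0 \<le> \<alpha>" "1 \<le> \<beta>"
    and d: "1 \<le> x" "1 \<le> y" and det: "x * \<beta> - y * \<alpha> = 1"
    and AB: "0 \<le> A" "0 \<le> B" "1 \<le> A + B"
    using e by (auto simp: side_extent_def corner_def side_dir_def)
  have bdd: "bounded ?C"
    using bounded_cell_of corner_set_bounds(2,3)[OF corner] by blast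
  let ?s = "chord_fun (sx, sy)" and ?t = "chord_fun (sx - \<alpha>, sy + \<beta>)"
    and ?A = "chord_fun (sx - \<alpha> + A * x, sy + \<beta> - A * y)" and ?B = "chord_fun (sx - B * x, sy + B * y)"
  have C: "?C = {p. ?s p < 0 \<and> ?t p > 0 \<and> ?A p > 0 \<and> ?B p < 0}"
    by (rule cell_of_corner[OF e])
  have pt: "\<exists>p. (?s p < 0 \<longleftrightarrow> 0 < z) \<and> (?s p > 0 \<longleftrightarrow> z < 0) \<and> (?t p < 0 \<longleftrightarrow> 1 < z) \<and> (?t p > 0 \<longleftrightarrow> z < 1) \<and>
      (?A p < 0 \<longleftrightarrow> of_int A * G + 1 < z) \<and> (?A p > 0 \<longleftrightarrow> z < of_int A * G + 1) \<and>
      (?B p < 0 \<longleftrightarrow> - of_int B * G < z) \<and> (?B p > 0 \<longleftrightarrow> z < - of_int B * G)"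
    if G: "of_int x + G * of_int \<alpha> > 0" "of_int y + G * of_int \<beta> > 0" for G z :: real
  proof -
    obtain p where
      p: "\<And>a i. chord_fun (sx + a * x - i * \<alpha>, sy - a * y + i * \<beta>) p < 0 \<longleftrightarrow> of_int a * G + of_int i < z"
      "\<And>a i. chord_fun (sx + a * x - i * \<alpha>, sy - a * y + i * \<beta>) p > 0 \<longleftrightarrow> of_int a * G + of_int i > z"
      by (rule projective_point[OF det G, of sx sy z]) blast
    have eqs: "?s = chord_fun (sx + 0 * x - 0 * \<alpha>, sy - 0 * y + 0 * \<beta>)"
      "?t = chord_fun (sx + 0 * x - 1 * \<alpha>, sy - 0 * y + 1 * \<beta>)"
      "?A = chord_fun (sx + A * x - 1 * \<alpha>, sy - A * y + 1 * \<beta>)"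
      "?B = chord_fun (sx + (- B) * x - 0 * \<alpha>, sy - (- B) * y + 0 * \<beta>)"
      by (simp_all add: algebra_simps)
    show ?thesis
      unfolding eqs by (intro exI[of _ p]) (unfold p, simp)
  qed
  have Gpos: "of_int x + G * of_int \<alpha> > 0" "of_int y + G * of_int \<beta> > 0" if "G \<ge> 0" for G :: real
    using that c d by (auto intro!: add_pos_nonneg)
  note pt_pos = pt[OF Gpos]
  \<comment> \<open>Small enough that \<open>G = -\<epsilon>\<close> is still admissible in
    \<open>projective_point\<close> and that \<open>A \<epsilon>\<close> and
    \<open>B \<epsilon>\<close> stay below 1/2, so the two cuts do not interfere.\<close>
  define \<epsilon> :: real where "\<epsilon> = 1 / ((of_int \<alpha> + of_int \<beta> + 1) * (2 * of_int A + 2 * of_int B + 1))"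
  have \<epsilon>: "0 < \<epsilon>" "of_int \<alpha> * \<epsilon> < 1" "of_int \<beta> * \<epsilon> < 1" "of_int A * \<epsilon> < 1/2" "of_int B * \<epsilon> < 1/2"
    using c AB by (simp_all add: \<epsilon>_def field_simps add_pos_nonneg add_nonneg_pos)
  have "of_int x + (-\<epsilon>) * of_int \<alpha> > 0" "of_int y + (-\<epsilon>) * of_int \<beta> > 0"
  proof -
    have "(of_int x :: real) \<ge> 1" "(of_int y :: real) \<ge> 1" using d by auto
    then show "of_int x + (-\<epsilon>) * of_int \<alpha> > 0" "of_int y + (-\<epsilon>) * of_int \<beta> > 0"
      using \<epsilon>(2,3) by (auto simp: mult.commute)
  qed
  note pt_neg = pt[OF this]
  have rA: "(of_int A :: real) \<ge> 0" "(of_int B :: real) \<ge> 0" using AB by auto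
  show ne: "?C \<noteq> {}"
    using pt_pos[of 1 "1/2"] rA unfolding C by (auto simp del: split_paired_Ex)
  have rA1: "A \<ge> 1 \<Longrightarrow> (of_int A :: real) \<ge> 1" "B \<ge> 1 \<Longrightarrow> (of_int B :: real) \<ge> 1" by simp_all
  have wA: "\<exists>p. ?s p < 0 \<and> ?t p > 0 \<and> ?A p < 0 \<and> ?B p < 0" if A: "A \<ge> 1"
  proof (rule ex_forward[OF pt_neg[of "1 - of_int A * \<epsilon> / 2"]])
    have "0 < of_int A * \<epsilon>" using A \<epsilon>(1) by simp
    then show "?s p < 0 \<and> ?t p > 0 \<and> ?A p < 0 \<and> ?B p < 0"
      if "(?s p < 0 \<longleftrightarrow> 0 < 1 - of_int A * \<epsilon> / 2) \<and> (?s p > 0 \<longleftrightarrow> 1 - of_int A * \<epsilon> / 2 < 0) \<and>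
        (?t p < 0 \<longleftrightarrow> 1 < 1 - of_int A * \<epsilon> / 2) \<and> (?t p > 0 \<longleftrightarrow> 1 - of_int A * \<epsilon> / 2 < 1) \<and>
        (?A p < 0 \<longleftrightarrow> of_int A * - \<epsilon> + 1 < 1 - of_int A * \<epsilon> / 2) \<and>
        (?A p > 0 \<longleftrightarrow> 1 - of_int A * \<epsilon> / 2 < of_int A * - \<epsilon> + 1) \<and>
        (?B p < 0 \<longleftrightarrow> - of_int B * - \<epsilon> < 1 - of_int A * \<epsilon> / 2) \<and>
        (?B p > 0 \<longleftrightarrow> 1 - of_int A * \<epsilon> / 2 < - of_int B * - \<epsilon>)" for p
      using that \<epsilon> by (simp add: field_simps)
  qed
  have wB: "\<exists>p. ?s p < 0 \<and> ?t p > 0 \<and> ?A p > 0 \<and> ?B p > 0" if B: "B \<ge> 1"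
  proof (rule ex_forward[OF pt_neg[of "of_int B * \<epsilon> / 2"]])
    have "0 < of_int B * \<epsilon>" using B \<epsilon>(1) by simp
    then show "?s p < 0 \<and> ?t p > 0 \<and> ?A p > 0 \<and> ?B p > 0"
      if "(?s p < 0 \<longleftrightarrow> 0 < of_int B * \<epsilon> / 2) \<and> (?s p > 0 \<longleftrightarrow> of_int B * \<epsilon> / 2 < 0) \<and>
        (?t p < 0 \<longleftrightarrow> 1 < of_int B * \<epsilon> / 2) \<and> (?t p > 0 \<longleftrightarrow> of_int B * \<epsilon> / 2 < 1) \<and>
        (?A p < 0 \<longleftrightarrow> of_int A * - \<epsilon> + 1 < of_int B * \<epsilon> / 2) \<and>
        (?A p > 0 \<longleftrightarrow> of_int B * \<epsilon> / 2 < of_int A * - \<epsilon> + 1) \<and>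
        (?B p < 0 \<longleftrightarrow> - of_int B * - \<epsilon> < of_int B * \<epsilon> / 2) \<and>
        (?B p > 0 \<longleftrightarrow> of_int B * \<epsilon> / 2 < - of_int B * - \<epsilon>)" for p
      using that \<epsilon> B by (simp add: field_simps)
  qed
  have ws: "\<exists>p. ?s p > 0 \<and> ?t p > 0 \<and> ?A p > 0 \<and> (B \<ge> 1 \<longrightarrow> ?B p < 0)"
    by (rule ex_forward[OF pt_pos[of 2 "-1"]]) (use rA rA1 in auto)
  have wt: "\<exists>p. ?s p < 0 \<and> ?t p < 0 \<and> (A \<ge> 1 \<longrightarrow> ?A p > 0) \<and> ?B p < 0"
    by (rule ex_forward[OF pt_pos[of 1 "3/2"]]) (use rA rA1 in auto)
  show "polygon_with_sides (if A \<ge> 1 \<and> B \<ge> 1 then 4 else 3) ?C"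
  proof -
    consider "A \<ge> 1" "B \<ge> 1" | "A \<ge> 1" "B = 0" | "A = 0" "B \<ge> 1" using AB by linarith
    then show ?thesis
    proof cases
      case 1
      have "polygon_with_sides 4 ?C"
        by (rule quadrilateral_if_affine_funs[of "\<lambda>p. - ?s p" ?t ?A "\<lambda>p. - ?B p"])
          (use ne bdd C wA wB ws wt 1 in \<open>simp_all add: affine_fun_intros conj_ac del: split_paired_Ex\<close>)
      then show ?thesis using 1 by simp
    next
      case 2
      have "polygon_with_sides 3 ?C"
        by (rule triangle_if_affine_funs[of "\<lambda>p. - ?s p" ?t ?A])
          (use ne bdd C wA ws wt 2 in \<open>auto simp: affine_fun_intros simp del: split_paired_Ex\<close>)
      then show ?thesis using 2 by simp
    next
      case 3
      have "polygon_with_sides 3 ?C"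
        by (rule triangle_if_affine_funs[of "\<lambda>p. - ?s p" ?t "\<lambda>p. - ?B p"])
          (use ne bdd C wB ws wt 3 in \<open>auto simp: affine_fun_intros simp del: split_paired_Ex\<close>)
      then show ?thesis using 3 by simp
    qed
  qed
qed

section \<open>Triangles on the top and the bottom side\<close>

lemma cell_of_top:
  assumes j: "0 \<le> j" "j < int n"
  defines "S \<equiv> {w \<in> grid n. snd w \<le> j}"
  shows "cell_of n S \<noteq> {}" "polygon_with_sides 3 (cell_of n S)"
proof -
  \<comment> \<open>The triangle hangs from the segment between \<open>(j, 1)\<close> and
    \<open>(j + 1, 1)\<close>; these are the flattest chords at its two ends, coming from the
    opposite lower corners of the rectangle.\<close>
  let ?s = "chord_fun (int n, j)" and ?t = "chord_fun (0, j + 1)"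
  have eq: "cell_of n S = {p. 1 - snd p > 0 \<and> - ?s p > 0 \<and> ?t p > 0}" (is "_ = ?R")
  proof
    show "cell_of n S \<subseteq> ?R"
      using j by (auto simp: cell_of_def S_def grid_def dest!: bspec[where x = "(int n, j)"] bspec[where x = "(0, j + 1)"])
    show "?R \<subseteq> cell_of n S"
    proof
      fix p assume p: "p \<in> ?R"
      have le: "real n * (1 - snd p) + of_int j * snd p < fst p" "fst p < (of_int j + 1) * snd p"
        using p by (auto simp: chord_fun_def)
      then have "real n * (1 - snd p) < snd p" by (simp add: algebra_simps)
      moreover have "real n * (1 - snd p) \<ge> 0" using p by simp
      ultimately have y: "0 < snd p" by linarith
      have "(w \<in> S \<longrightarrow> chord_fun w p < 0) \<and> (w \<notin> S \<longrightarrow> chord_fun w p > 0)" if w: "w \<in> grid n" for w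
      proof -
        have w': "0 \<le> fst w" "of_int (fst w) \<le> real n" using w by (auto simp: grid_def)
        have fw: "0 \<le> of_int (fst w) * (1 - snd p)" "of_int (fst w) * (1 - snd p) \<le> real n * (1 - snd p)"
          using w' p by (auto intro!: mult_right_mono)
        show ?thesis
        proof (cases "snd w \<le> j")
          case True
          then have "of_int (snd w) * snd p \<le> of_int j * snd p" using y by (intro mult_right_mono) auto
          then have "chord_fun w p < 0" using fw le by (simp add: chord_fun_def)
          then show ?thesis using True w by (simp add: S_def)
        next
          case False
          then have "(of_int j + 1) * snd p \<le> of_int (snd w) * snd p" using y
            by (intro mult_right_mono) linarith+
          then have "chord_fun w p > 0" using fw le by (simp add: chord_fun_def)
          then show ?thesis using False w by (simp add: S_def)
        qed
      qed
      then show "p \<in> cell_of n S" using y p by (simp add: cell_of_def)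
    qed
  qed
  have bdd: "bounded (cell_of n S)"
    by (rule bounded_cell_of) (use j in \<open>auto simp: S_def grid_def\<close>)
  have n: "real n \<ge> 1" and j0: "0 \<le> (of_int j :: real)" using j by simp_all
  define \<epsilon> where "\<epsilon> = 1 / (4 * (real n + 1))"
  have \<epsilon>: "real n * \<epsilon> < 1 / 2" "\<epsilon> < 1 / 2" "0 < \<epsilon>" by (simp_all add: \<epsilon>_def field_simps)
  have "(of_int j * (1 - \<epsilon>) + 1 / 2, 1 - \<epsilon>) \<in> cell_of n S"
    unfolding eq using \<epsilon> by (simp add: chord_fun_def algebra_simps)
  then show ne: "cell_of n S \<noteq> {}" by blast
  show "polygon_with_sides 3 (cell_of n S)"
  proof (rule triangle_if_affine_funs[OF _ _ _ eq ne bdd])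
    show "\<exists>w. 1 - snd w < 0 \<and> - ?s w > 0 \<and> ?t w > 0"
      by (rule exI[of _ "(2 * of_int j + 1, 2)"]) (use n in \<open>simp add: chord_fun_def algebra_simps\<close>)
    show "\<exists>w. 1 - snd w > 0 \<and> - ?s w < 0 \<and> ?t w > 0"
      by (rule exI[of _ "(-1, 1/2)"]) (use n j0 in \<open>simp add: chord_fun_def field_simps\<close>)
    show "\<exists>w. 1 - snd w > 0 \<and> - ?s w > 0 \<and> ?t w < 0"
      by (rule exI[of _ "(of_int j + 1 + real n, 1/2)"]) (use n j0 in \<open>simp add: chord_fun_def field_simps\<close>)
  qed (rule affine_fun_intros)+
qed

lemma cell_of_bottom:
  assumes j: "0 \<le> j" "j < int n"
  defines "S \<equiv> {w \<in> grid n. fst w \<le> j}"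
  shows "cell_of n S \<noteq> {}" "polygon_with_sides 3 (cell_of n S)"
proof -
  \<comment> \<open>The triangle stands on the segment between \<open>(j, 0)\<close> and
    \<open>(j + 1, 0)\<close>, below the chords from its ends to the opposite upper corners.\<close>
  let ?s = "chord_fun (j, int n)" and ?t = "chord_fun (j + 1, 0)"
  have eq: "cell_of n S = {p. snd p > 0 \<and> - ?s p > 0 \<and> ?t p > 0}" (is "_ = ?R")
  proof
    show "cell_of n S \<subseteq> ?R"
      using j by (auto simp: cell_of_def S_def grid_def dest!: bspec[where x = "(j, int n)"] bspec[where x = "(j + 1, 0)"])
    show "?R \<subseteq> cell_of n S"
    proof
      fix p assume p: "p \<in> ?R"
      have le: "real n * snd p + of_int j * (1 - snd p) < fst p" "fst p < (of_int j + 1) * (1 - snd p)"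
        using p by (auto simp: chord_fun_def)
      then have "real n * snd p < 1 - snd p" by (simp add: algebra_simps)
      moreover have "real n * snd p \<ge> 0" using p by simp
      ultimately have y: "snd p < 1" by linarith
      have "(w \<in> S \<longrightarrow> chord_fun w p < 0) \<and> (w \<notin> S \<longrightarrow> chord_fun w p > 0)" if w: "w \<in> grid n" for w
      proof -
        have w': "0 \<le> snd w" "of_int (snd w) \<le> real n" using w by (auto simp: grid_def)
        have fw: "0 \<le> of_int (snd w) * snd p" "of_int (snd w) * snd p \<le> real n * snd p"
          using w' p by (auto intro!: mult_right_mono)
        show ?thesis
        proof (cases "fst w \<le> j")
          case True
          then have "of_int (fst w) * (1 - snd p) \<le> of_int j * (1 - snd p)"
            using y by (intro mult_right_mono) auto
          then have "chord_fun w p < 0" using fw le by (simp add: chord_fun_def)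
          then show ?thesis using True w by (simp add: S_def)
        next
          case False
          then have "(of_int j + 1) * (1 - snd p) \<le> of_int (fst w) * (1 - snd p)" using y
            by (intro mult_right_mono) linarith+
          then have "chord_fun w p > 0" using fw le by (simp add: chord_fun_def)
          then show ?thesis using False w by (simp add: S_def)
        qed
      qed
      then show "p \<in> cell_of n S" using y p by (simp add: cell_of_def)
    qed
  qed
  have bdd: "bounded (cell_of n S)"
    by (rule bounded_cell_of) (use j in \<open>auto simp: S_def grid_def\<close>)
  have n: "real n \<ge> 1" and j0: "0 \<le> (of_int j :: real)" using j by simp_all
  define \<epsilon> where "\<epsilon> = 1 / (4 * (real n + 1))"
  have \<epsilon>: "real n * \<epsilon> < 1 / 2" "\<epsilon> < 1 / 2" "0 < \<epsilon>" by (simp_all add: \<epsilon>_def field_simps)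
  have "(of_int j * (1 - \<epsilon>) + 1 / 2, \<epsilon>) \<in> cell_of n S"
    unfolding eq using \<epsilon> by (simp add: chord_fun_def algebra_simps)
  then show ne: "cell_of n S \<noteq> {}" by blast
  show "polygon_with_sides 3 (cell_of n S)"
  proof (rule triangle_if_affine_funs[OF _ _ _ eq ne bdd])
    show "\<exists>w. snd w < 0 \<and> - ?s w > 0 \<and> ?t w > 0"
      by (rule exI[of _ "(2 * of_int j + 1, -1)"]) (use n in \<open>simp add: chord_fun_def algebra_simps\<close>)
    show "\<exists>w. snd w > 0 \<and> - ?s w < 0 \<and> ?t w > 0"
      by (rule exI[of _ "(-1, 1/2)"]) (use n j0 in \<open>simp add: chord_fun_def field_simps\<close>)
    show "\<exists>w. snd w > 0 \<and> - ?s w > 0 \<and> ?t w < 0"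
      by (rule exI[of _ "(of_int j + 1 + real n, 1/2)"]) (use n j0 in \<open>simp add: chord_fun_def field_simps\<close>)
  qed (rule affine_fun_intros)+
qed

text \<open>Identifies the hanging triangles with the corners \<open>\<alpha> = n\<close>,
  \<open>\<beta> = 1\<close>: there \<open>b\<close> outweighs \<open>a\<close> in the level, since
  \<open>a\<close> varies by at most \<open>n\<close>.\<close>

lemma corner_set_special:
  assumes "corner (int n) sx sy (int n) 1"
  shows "corner_set n sx sy (int n) 1 = {w \<in> grid n. snd w \<le> sy}"
proof -
  have c: "sx = int n" "0 \<le> sy" "sy < int n" using assms by (auto simp: corner_def inbox_def)
  have key: "(a - int n) * 1 + (b - sy) * int n < 0 \<or> (a - int n) * 1 + (b - sy) * int n = 0 \<and> b \<le> sy \<longleftrightarrow> b \<le> sy"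
    if "0 \<le> a" "a \<le> int n" for a b
  proof (cases "b \<le> sy")
    case True
    then have "(b - sy) * int n \<le> 0" by (simp add: mult_nonpos_nonneg)
    then show ?thesis using that True by (smt (verit))
  next
    case False
    then have "1 * int n \<le> (b - sy) * int n" by (intro mult_right_mono) auto
    then show ?thesis using that False by (smt (verit))
  qed
  show ?thesis
  proof (intro set_eqI)
    fix w :: "int \<times> int"
    obtain a b where w: "w = (a, b)" by (cases w)
    show "w \<in> corner_set n sx sy (int n) 1 \<longleftrightarrow> w \<in> {w \<in> grid n. snd w \<le> sy}"
      using key[of a b] unfolding w mem_corner_set c mem_Collect_eq mem_grid inbox_def snd_conv by blast
  qed
qed

text \<open>The cell of a generic point \<open>p\<close> is recognised from its lowest vertex, the highest crossing
  below \<open>p\<close> of a chord to the left of \<open>p\<close> with a chord to the right of it.\<close>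

lemma generic_point_cell:
  assumes p: "0 < fst p" "fst p < real n" "0 < snd p" "snd p < 1"
    and nz: "\<And>w. w \<in> grid n \<Longrightarrow> chord_fun w p \<noteq> 0"
  defines "S \<equiv> {w \<in> grid n. chord_fun w p < 0}"
  shows "(\<exists>sx sy \<alpha> \<beta>. corner (int n) sx sy \<alpha> \<beta> \<and> S = corner_set n sx sy \<alpha> \<beta>) \<or>
    (\<exists>j. 0 \<le> j \<and> j < int n \<and> S = {w \<in> grid n. fst w \<le> j})"
proof -
  have neg: "chord_fun w p < 0" if "w \<in> S" for w using that by (simp add: S_def)
  have pos: "chord_fun w p > 0" if "w \<in> grid n" "w \<notin> S" for w
    using that nz[of w] by (auto simp: S_def)
  have Sg: "S \<subseteq> grid n" by (auto simp: S_def)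
  have finS: "finite S" by (simp add: S_def)
  have S0: "(0, 0) \<in> S" using p by (simp add: S_def grid_def chord_fun_def)
  have Sn: "(int n, int n) \<notin> S" using p by (simp add: S_def chord_fun_def algebra_simps)
  \<comment> \<open>Pairs with \<open>s\<close> left and \<open>t\<close> right of \<open>p\<close>
    whose order on the bottom side is not the same: they cross below \<open>p\<close> or meet on the
    bottom side. If there are none, \<open>p\<close> lies in a triangle on the bottom side.\<close>
  define M where "M = {(s, t). s \<in> S \<and> t \<in> grid n - S \<and> fst t \<le> fst s}"
  have "M \<subseteq> grid n \<times> grid n" by (auto simp: M_def S_def)
  then have finM: "finite M" by (rule finite_subset) simp
  show ?thesis
  proof (cases "M = {}")
    case True
    define j where "j = Max (fst ` S)"
    have "j \<in> fst ` S" unfolding j_def using finS S0 by (intro Max_in) auto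
    then obtain s where s: "s \<in> S" "fst s = j" by auto
    have le: "fst w \<le> j" if "w \<in> S" for w unfolding j_def using that finS by simp
    have gt: "fst w > j" if "w \<in> grid n" "w \<notin> S" for w
    proof -
      have "(s, w) \<notin> M" using True by simp
      then show ?thesis using that s by (auto simp: M_def)
    qed
    have "w \<in> S \<longleftrightarrow> fst w \<le> j" if "w \<in> grid n" for w using le[of w] gt[of w] that by force
    then have "S = {w \<in> grid n. fst w \<le> j}"
      using Sg by blast
    moreover have "0 \<le> j" using le[OF S0] by simp
    moreover have "j < int n" using gt[of "(int n, int n)"] Sn by (simp add: grid_def)
    ultimately show ?thesis by blast
  next
    case False
    \<comment> \<open>A crossing with direction \<open>(-\<alpha>, \<beta>)\<close> has height
      \<open>\<alpha> / (\<alpha> + \<beta>)\<close>, which increases with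
      \<open>\<alpha> / \<beta>\<close>. So maximal slope means highest crossing, and minimal
      \<open>height\<close> then selects neighbours on the lattice line.\<close>
    define slope where "slope x = (real_of_int (fst (fst x) - fst (snd x)) / real_of_int (snd (snd x) - snd (fst x)))"
      for x :: "(int \<times> int) \<times> (int \<times> int)"
    define height where "height x = snd (snd x) - snd (fst x)" for x :: "(int \<times> int) \<times> (int \<times> int)"
    have FD: "of_int (fst t - fst s) * (1 - snd p) + of_int (snd t - snd s) * snd p > 0"
      if "s \<in> S" "t \<in> grid n" "t \<notin> S" for s t
      using neg[OF that(1)] pos[OF that(2,3)] by (simp add: chord_fun_def algebra_simps)
    have height: "height x > 0" if "x \<in> M" for x
    proof -
      obtain s t where x: "x = (s, t)" by (cases x)
      have "of_int (fst t - fst s) * (1 - snd p) \<le> 0"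
        using that p by (auto simp: M_def x mult_nonpos_nonneg)
      then have "of_int (snd t - snd s) * snd p > 0"
        using FD[of s t] that by (auto simp: M_def x)
      then show ?thesis using p by (simp add: height_def x zero_less_mult_iff)
    qed
    have "Max (slope ` M) \<in> slope ` M" using finM False by (intro Max_in) auto
    then obtain x0 where x0: "x0 \<in> M" "slope x0 = Max (slope ` M)" by auto
    have x0_max: "slope z \<le> slope x0" if "z \<in> M" for z
      using that finM by (simp add: x0(2))
    define M' where "M' = {z \<in> M. slope z = slope x0}"
    have M': "finite M'" "x0 \<in> M'" using finM x0 by (auto simp: M'_def)
    have "Min (height ` M') \<in> height ` M'" using M' by (intro Min_in) auto
    then obtain x where x: "x \<in> M'" "height x = Min (height ` M')" by auto
    have x_min: "height x \<le> height z" if "z \<in> M'" for z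
      using that M' by (simp add: x(2))
    obtain sx sy tx ty where st: "x = ((sx, sy), (tx, ty))" by (metis prod.collapse)
    define \<alpha> \<beta> where "\<alpha> = sx - tx" and "\<beta> = ty - sy"
    have t: "tx = sx - \<alpha>" "ty = sy + \<beta>" by (auto simp: \<alpha>_def \<beta>_def)
    have sS: "(sx, sy) \<in> S" and tS: "(tx, ty) \<notin> S" and tg: "(tx, ty) \<in> grid n"
      and ab: "0 \<le> \<alpha>" "1 \<le> \<beta>"
      using x height[of x] by (auto simp: M'_def M_def st \<alpha>_def \<beta>_def height_def)
    have sg: "(sx, sy) \<in> grid n" using sS by (simp add: S_def)
    have opt: "\<alpha>' * \<beta> \<le> \<alpha> * \<beta>' \<and> (\<alpha>' * \<beta> = \<alpha> * \<beta>' \<longrightarrow> \<beta> \<le> \<beta>')"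
      if M: "((s'x, s'y), (t'x, t'y)) \<in> M" and \<alpha>': "\<alpha>' = s'x - t'x" and \<beta>': "\<beta>' = t'y - s'y" for s'x s'y t'x t'y \<alpha>' \<beta>'
    proof -
      have b': "\<beta>' > 0" using height[OF M] \<beta>' by (simp add: height_def)
      have sl: "slope ((s'x, s'y), (t'x, t'y)) = of_int \<alpha>' / of_int \<beta>'" "slope x = of_int \<alpha> / of_int \<beta>"
        using \<alpha>' \<beta>' by (simp_all add: slope_def st \<alpha>_def \<beta>_def)
      have x0x: "slope x0 = slope x" using x(1) by (simp add: M'_def)
      have "of_int \<alpha>' / of_int \<beta>' \<le> of_int \<alpha> / (of_int \<beta> :: real)"
        using x0_max[OF M] unfolding x0x sl .
      then have "of_int \<alpha>' * of_int \<beta> \<le> of_int \<alpha> * (of_int \<beta>' :: real)"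
        using b' ab by (simp add: field_simps)
      then have 1: "\<alpha>' * \<beta> \<le> \<alpha> * \<beta>'" by (simp flip: of_int_mult)
      have "\<beta> \<le> \<beta>'" if eq: "\<alpha>' * \<beta> = \<alpha> * \<beta>'"
      proof -
        have "of_int \<alpha>' * of_int \<beta> = of_int \<alpha> * (of_int \<beta>' :: real)"
          using eq by (metis of_int_mult)
        then have "of_int \<alpha>' / of_int \<beta>' = of_int \<alpha> / (of_int \<beta> :: real)"
          using b' ab by (simp add: field_simps)
        then have "((s'x, s'y), (t'x, t'y)) \<in> M'"
          using M by (simp add: M'_def x0x sl)
        then show ?thesis using x_min \<beta>' by (auto simp: height_def st \<beta>_def)
      qed
      then show ?thesis using 1 by blast
    qed
    have FDab: "of_int \<beta> * snd p > of_int \<alpha> * (1 - snd p)"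
      using FD[OF sS tg tS] by (simp add: \<alpha>_def \<beta>_def algebra_simps)
    \<comment> \<open>No chord on the right has a smaller level than a chord on the left. If the
      pair is in \<open>M\<close>, this is maximality of the slope; otherwise the order of the two
      chords at \<open>p\<close> contradicts \<open>FDab\<close>.\<close>
    have key: False if "(ax, ay) \<in> S" "(bx, bY) \<in> grid n" "(bx, bY) \<notin> S" "(bx - ax) * \<beta> + (bY - ay) * \<alpha> < 0"
      for ax ay bx bY
    proof -
      define \<alpha>' \<beta>' where "\<alpha>' = ax - bx" and "\<beta>' = bY - ay"
      have l: "\<alpha> * \<beta>' < \<alpha>' * \<beta>" using that(4) by (simp add: \<alpha>'_def \<beta>'_def algebra_simps)
      show False
      proof (cases "\<alpha>' \<ge> 0")
        case True
        then have "((ax, ay), (bx, bY)) \<in> M" using that by (auto simp: M_def \<alpha>'_def)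
        then show False using opt[OF _ \<alpha>'_def \<beta>'_def] l by auto
      next
        case False
        then have "\<alpha>' * \<beta> < 0" using ab by (simp add: mult_less_0_iff)
        then have "\<beta>' < 0" using l ab by (smt (verit) mult_nonneg_nonneg)
        have "of_int \<alpha>' * (1 - snd p) < of_int \<beta>' * snd p"
          using FD[OF that(1-3)] by (simp add: \<alpha>'_def \<beta>'_def algebra_simps)
        then have "of_int \<beta> * (of_int \<alpha>' * (1 - snd p)) \<le> of_int \<beta> * (of_int \<beta>' * snd p)"
          using ab by (intro mult_left_mono) auto
        also have "\<dots> = of_int \<beta>' * (of_int \<beta> * snd p)" by simp
        also have "\<dots> \<le> of_int \<beta>' * (of_int \<alpha> * (1 - snd p))"
          using FDab \<open>\<beta>' < 0\<close> by (intro mult_left_mono_neg) auto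
        finally have "(of_int (\<alpha>' * \<beta>) :: real) * (1 - snd p) \<le> of_int (\<alpha> * \<beta>') * (1 - snd p)"
          by (simp add: algebra_simps)
        then have "\<alpha>' * \<beta> \<le> \<alpha> * \<beta>'" using p by (simp flip: of_int_mult)
        then show False using l by simp
      qed
    qed
    \<comment> \<open>A grid point between \<open>s\<close> and \<open>t\<close> lies on one of the
      two sides of \<open>p\<close>, and with \<open>t\<close> or \<open>s\<close> it forms a pair
      of the same slope and smaller \<open>height\<close>.\<close>
    have cop: "coprime \<alpha> \<beta>"
    proof (rule ccontr)
      assume nc: "\<not> coprime \<alpha> \<beta>"
      define g where "g = gcd \<alpha> \<beta>"
      obtain a b where gab: "\<alpha> = g * a" "\<beta> = g * b" unfolding g_def by (metis gcd_dvd1 gcd_dvd2 dvdE)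
      have g: "g \<ge> 2"
      proof -
        have "g \<noteq> 1" using nc by (simp add: g_def coprime_iff_gcd_eq_1)
        moreover have "g > 0" using ab by (simp add: g_def)
        ultimately show ?thesis by linarith
      qed
      have ab': "0 \<le> a" "1 \<le> b" "a \<le> \<alpha>" "b < \<beta>"
      proof -
        have "0 \<le> g * a" "0 < g * b" using ab unfolding gab by linarith+
        then show *: "0 \<le> a" "1 \<le> b" using g by (auto simp: zero_le_mult_iff zero_less_mult_iff)
        show "a \<le> \<alpha>" "b < \<beta>"
          using * g mult_right_mono[of 1 g a] mult_strict_right_mono[of 1 g b] unfolding gab by linarith+
      qed
      have wg: "(sx - a, sy + b) \<in> grid n"
        using sg tg ab' ab by (auto simp: mem_grid inbox_def t)
      show False
      proof (cases "(sx - a, sy + b) \<in> S")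
        case True
        then have "((sx - a, sy + b), (tx, ty)) \<in> M" using tS tg ab' by (auto simp: M_def t)
        from opt[OF this refl refl] show False
          using ab' by (auto simp: t gab algebra_simps)
      next
        case False
        then have "((sx, sy), (sx - a, sy + b)) \<in> M" using sS wg ab' by (auto simp: M_def)
        from opt[OF this refl refl] show False
          using ab' by (auto simp: t gab algebra_simps)
      qed
    qed
    have "corner (int n) sx sy \<alpha> \<beta>"
      using ab cop sg tg by (simp add: corner_def mem_grid t)
    moreover have "w \<in> S \<longleftrightarrow> w \<in> corner_set n sx sy \<alpha> \<beta>" if w: "w \<in> grid n" for w
    proof -
      obtain wx wy where wxy: "w = (wx, wy)" by (cases w)
      define l where "l = (wx - sx) * \<beta> + (wy - sy) * \<alpha>"
      have mem: "w \<in> corner_set n sx sy \<alpha> \<beta> \<longleftrightarrow> l < 0 \<or> l = 0 \<and> wy \<le> sy"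
        using w by (simp add: wxy mem_corner_set mem_grid l_def)
      consider "l < 0" | "l > 0" | "l = 0" by linarith
      then show ?thesis
      proof cases
        case 1
        then show ?thesis using key[OF sS, of wx wy] w mem by (auto simp: wxy l_def)
      next
        case 2
        have "(tx - wx) * \<beta> + (ty - wy) * \<alpha> = - l" by (simp add: l_def t algebra_simps)
        then show ?thesis using key[of wx wy tx ty] tg tS 2 mem by (auto simp: wxy)
      next
        case 3
        then have eq: "(wy - sy) * \<alpha> = (sx - wx) * \<beta>" by (simp add: l_def algebra_simps)
        then have "\<beta> dvd (wy - sy) * \<alpha>" by simp
        then have "\<beta> dvd wy - sy" using cop by (metis coprime_commute coprime_dvd_mult_left_iff)
        then obtain i where i: "wy - sy = i * \<beta>" by (metis dvdE mult.commute)
        have "(sx - wx) * \<beta> = (i * \<alpha>) * \<beta>" unfolding eq[symmetric] i by (simp add: algebra_simps)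
        then have "sx - wx = i * \<alpha>" using ab by (metis mult_right_cancel not_one_le_zero)
        then have wx: "wx - sx = - (i * \<alpha>)" by simp
        have Fw: "chord_fun w p = chord_fun (sx, sy) p + of_int i * (of_int \<beta> * snd p - of_int \<alpha> * (1 - snd p))"
        proof -
          have "w = (sx + 0 * 0 - i * \<alpha>, sy - 0 * 0 + i * \<beta>)" using i wx by (simp add: wxy)
          then show ?thesis using chord_fun_lattice[of sx 0 0 i \<alpha> sy 0 \<beta> p] by simp
        qed
        have Ft: "chord_fun (tx, ty) p = chord_fun (sx, sy) p + (of_int \<beta> * snd p - of_int \<alpha> * (1 - snd p))"
          by (simp add: chord_fun_def t algebra_simps)
        show ?thesis
        proof (cases "i \<le> 0")
          case True
          then have "of_int i * (of_int \<beta> * snd p - of_int \<alpha> * (1 - snd p)) \<le> 0"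
            using FDab by (intro mult_nonpos_nonneg) auto
          then have "w \<in> S" using Fw neg[OF sS] w by (simp add: S_def)
          moreover have "wy \<le> sy" using True i ab mult_nonpos_nonneg[of i \<beta>] by simp
          ultimately show ?thesis using mem 3 by simp
        next
          case False
          then have "of_int i * (of_int \<beta> * snd p - of_int \<alpha> * (1 - snd p)) \<ge>
              1 * (of_int \<beta> * snd p - of_int \<alpha> * (1 - snd p))"
            using FDab by (intro mult_right_mono) auto
          then have "w \<notin> S" using Fw Ft pos[OF tg tS] by (simp add: S_def)
          moreover have "i * \<beta> > 0" using False ab by (intro mult_pos_pos) auto
          then have "wy > sy" using i by linarith
          ultimately show ?thesis using mem 3 by simp
        qed
      qed
    qed
    then have "S = corner_set n sx sy \<alpha> \<beta>"
      by (auto simp: S_def corner_set_def)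
    ultimately show ?thesis by blast
  qed
qed

section \<open>Counting\<close>

text \<open>The lower left corners of the boxes of size \<open>d\<close> that fit into the square;
  their number is the weight in \<open>V\<close>.\<close>

definition offsets :: "int \<Rightarrow> int \<times> int \<Rightarrow> (int \<times> int) set" where
  "offsets n d = {0..n - fst d} \<times> {0..n - snd d}"

definition steps :: "int \<Rightarrow> int \<Rightarrow> (int \<times> int) set" where
  "steps n q = {(a, b). 1 \<le> a \<and> a \<le> n \<and> 1 \<le> b \<and> b \<le> n \<and> gcd a b = q}"

lemma finite_steps [simp]: "finite (steps n q)"
  by (rule finite_subset[of _ "{1..n} \<times> {1..n}"]) (auto simp: steps_def)

lemma finite_offsets [simp]: "finite (offsets n d)"
  by (simp add: offsets_def)

lemma card_offsets:
  assumes "fst d \<le> n" "snd d \<le> n"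
  shows "int (card (offsets n d)) = (n + 1 - fst d) * (n + 1 - snd d)"
  using assms by (simp add: offsets_def card_cartesian_product algebra_simps)

lemma V_eq_card: "V n n q = int (card (Sigma (steps (int n) (int q)) (offsets (int n))))"
proof -
  have "V n n q = (\<Sum>(a, b)\<in>(SIGMA a:{1..n}. {b. 1 \<le> b \<and> b \<le> n \<and> gcd a b = q}).
      (int n + 1 - int a) * (int n + 1 - int b))"
    unfolding V_def by (rule sum.Sigma) auto
  also have "\<dots> = (\<Sum>d\<in>steps (int n) (int q). (int n + 1 - fst d) * (int n + 1 - snd d))"
  proof (rule sum.reindex_bij_witness[of _ "map_prod nat nat" "map_prod int int"])
    fix d assume d: "d \<in> steps (int n) (int q)"
    then obtain a b where "d = (int a, int b)"
      unfolding steps_def by clarsimp (metis zero_le_imp_eq_int zero_less_one_class.zero_le_one order_trans)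
    with d show "map_prod nat nat d \<in> (SIGMA a:{1..n}. {b. 1 \<le> b \<and> b \<le> n \<and> gcd a b = q})"
      by (auto simp: steps_def gcd_int_int_eq)
  qed (auto simp: steps_def gcd_int_int_eq)
  also have "\<dots> = (\<Sum>d\<in>steps (int n) (int q). int (card (offsets (int n) d)))"
    by (intro sum.cong refl card_offsets[symmetric]) (auto simp: steps_def)
  finally show ?thesis by simp
qed

definition corners :: "int \<Rightarrow> (int \<times> int \<times> int \<times> int) set" where
  "corners n = {(sx, sy, \<alpha>, \<beta>). corner n sx sy \<alpha> \<beta>}"

definition right_corners :: "int \<Rightarrow> (int \<times> int \<times> int \<times> int) set" where
  "right_corners n = {(sx, sy, \<alpha>, \<beta>). corner n sx sy \<alpha> \<beta> \<and>
     (\<exists>x y. side_dir n sx sy \<alpha> \<beta> x y \<and> right_vertex n sx sy \<alpha> \<beta> x y)}"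

definition left_corners :: "int \<Rightarrow> (int \<times> int \<times> int \<times> int) set" where
  "left_corners n = {(sx, sy, \<alpha>, \<beta>). corner n sx sy \<alpha> \<beta> \<and>
     (\<exists>x y. side_dir n sx sy \<alpha> \<beta> x y \<and> left_vertex n sx sy x y)}"

text \<open>A corner is a primitive step together with the position of the bounding box of
  \<open>s\<close> and \<open>t\<close>. The extra summand comes from \<open>\<alpha> = 0\<close>,
  where primitivity forces \<open>\<beta> = 1\<close>.\<close>

lemma card_corners:
  "finite (corners (int n))" "int (card (corners (int n))) = V n n 1 + int n * (int n + 1)"
proof -
  let ?N = "int n"
  let ?Z = "Sigma (insert (0, 1) (steps ?N 1)) (offsets ?N)"
  have bij: "bij_betw (\<lambda>(sx, sy, \<alpha>, \<beta>). ((\<alpha>, \<beta>), (sx - \<alpha>, sy))) (corners ?N) ?Z"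
  proof (rule bij_betwI[where g = "\<lambda>((\<alpha>, \<beta>), (u, v)). (u + \<alpha>, v, \<alpha>, \<beta>)"])
    show "(\<lambda>(sx, sy, \<alpha>, \<beta>). ((\<alpha>, \<beta>), (sx - \<alpha>, sy))) \<in> corners ?N \<rightarrow> ?Z"
    proof (clarsimp simp: corners_def)
      fix sx sy \<alpha> \<beta> assume c: "corner ?N sx sy \<alpha> \<beta>"
      have "\<beta> = 1" if "\<alpha> = 0" using c that by (auto simp: corner_def)
      then show "(\<alpha> = 0 \<and> \<beta> = 1 \<or> (\<alpha>, \<beta>) \<in> steps ?N 1) \<and> (sx - \<alpha>, sy) \<in> offsets ?N (\<alpha>, \<beta>)"
        using c by (cases "\<alpha> = 0") (auto simp: corner_def inbox_def steps_def offsets_def coprime_iff_gcd_eq_1)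
    qed
    show "(\<lambda>((\<alpha>, \<beta>), (u, v)). (u + \<alpha>, v, \<alpha>, \<beta>)) \<in> ?Z \<rightarrow> corners ?N"
      by (auto simp: corners_def corner_def inbox_def steps_def offsets_def coprime_iff_gcd_eq_1)
  qed auto
  have finZ: "finite ?Z" by (intro finite_SigmaI) auto
  then show "finite (corners ?N)" using bij bij_betw_finite by blast
  have ni: "(0, 1) \<notin> steps ?N 1" by (simp add: steps_def)
  have "int (card ?Z) = (\<Sum>d\<in>insert (0, 1) (steps ?N 1). int (card (offsets ?N d)))"
    by simp
  also have "\<dots> = int (card (offsets ?N (0, 1))) + (\<Sum>d\<in>steps ?N 1. int (card (offsets ?N d)))"
    using ni by (subst sum.insert) auto
  also have "(\<Sum>d\<in>steps ?N 1. int (card (offsets ?N d))) = V n n 1"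
    unfolding V_eq_card by simp
  also have "int (card (offsets ?N (0, 1))) = ?N * (?N + 1)"
    by (simp add: offsets_def card_cartesian_product algebra_simps)
  finally show "int (card (corners ?N)) = V n n 1 + ?N * (?N + 1)"
    using bij_betw_same_card[OF bij] by simp
qed

text \<open>An inner node is encoded by the extreme pair \<open>t\<close>, \<open>X\<close> of its lattice line.\<close>

definition node_steps :: "int \<Rightarrow> (int \<times> int \<times> int \<times> int) set" where
  "node_steps n = {(tx, ty, x, y). 1 \<le> x \<and> 1 \<le> y \<and> coprime x y \<and> inbox n tx ty \<and>
     inbox n (tx + x) (ty - y) \<and> \<not> inbox n (tx - x) (ty + y)}"

text \<open>On each lattice line the neighbour pairs (\<open>W\<close>) exceed the consecutive
  triples (\<open>W2\<close>) by one. Joining the outer points of a triple gives a step of gcd 2,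
  and every such step has a lattice point in the middle.\<close>

lemma card_node_steps: "int (card (node_steps (int n))) = V n n 1 - V n n 2"
proof -
  let ?N = "int n"
  define W where "W = {(tx, ty, x, y). 1 \<le> x \<and> 1 \<le> y \<and> coprime x y \<and> inbox ?N tx ty \<and> inbox ?N (tx + x) (ty - y)}"
  define W2 where "W2 = {(tx, ty, x, y) \<in> W. inbox ?N (tx - x) (ty + y)}"
  have bij1: "bij_betw (\<lambda>(tx, ty, x, y). ((x, y), (tx, ty - y))) W (Sigma (steps ?N 1) (offsets ?N))"
    by (rule bij_betwI[where g = "\<lambda>((x, y), (u, v)). (u, v + y, x, y)"])
      (auto simp: W_def inbox_def steps_def offsets_def coprime_iff_gcd_eq_1)
  have g: "gcd (2 * x) (2 * y) = 2" if "coprime x y" for x y :: int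
    using that gcd_mult_distrib_int[of 2 x y] by (simp add: coprime_iff_gcd_eq_1)
  have halves: "2 dvd a \<and> 2 dvd b \<and> coprime (a div 2) (b div 2)" if "gcd a b = 2" for a b :: int
  proof -
    have "2 dvd a" "2 dvd b" using that by (metis gcd_dvd1, metis gcd_dvd2)
    then obtain c d where cd: "a = 2 * c" "b = 2 * d" by (auto elim!: dvdE)
    have "gcd c d = 1" using that gcd_mult_distrib_int[of 2 c d] by (simp add: cd)
    then show ?thesis by (simp add: cd coprime_iff_gcd_eq_1)
  qed
  have even: "2 * (a div 2) = a" "2 * (b div 2) = b" if "gcd a b = 2" for a b :: int
    using halves[OF that] by auto
  have bij2: "bij_betw (\<lambda>(tx, ty, x, y). ((2 * x, 2 * y), (tx - x, ty - y))) W2 (Sigma (steps ?N 2) (offsets ?N))"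
  proof (rule bij_betwI[where g = "\<lambda>((a, b), (u, v)). (u + a div 2, v + b div 2, a div 2, b div 2)"])
    show "(\<lambda>(tx, ty, x, y). ((2 * x, 2 * y), (tx - x, ty - y))) \<in> W2 \<rightarrow> Sigma (steps ?N 2) (offsets ?N)"
      using g by (auto simp: W_def W2_def inbox_def steps_def offsets_def)
    show "(\<lambda>((a, b), (u, v)). (u + a div 2, v + b div 2, a div 2, b div 2)) \<in> Sigma (steps ?N 2) (offsets ?N) \<rightarrow> W2"
    proof (rule Pi_I)
      fix z assume z: "z \<in> Sigma (steps ?N 2) (offsets ?N)"
      obtain a b u v where abuv: "z = ((a, b), (u, v))" by (metis surj_pair)
      then have *: "1 \<le> a" "a \<le> ?N" "1 \<le> b" "b \<le> ?N" "gcd a b = 2" "0 \<le> u" "u \<le> ?N - a" "0 \<le> v" "v \<le> ?N - b"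
        using z by (auto simp: steps_def offsets_def)
      obtain c d where cd: "a = 2 * c" "b = 2 * d" using halves[OF *(5)] by (auto elim!: dvdE)
      have "(u + c, v + d, c, d) \<in> W2"
        using * halves[OF *(5)] unfolding cd by (auto simp: W2_def W_def inbox_def)
      then show "(\<lambda>((a, b), (u, v)). (u + a div 2, v + b div 2, a div 2, b div 2)) z \<in> W2"
        by (simp add: abuv cd)
    qed
  qed (use even in \<open>auto simp: steps_def\<close>)
  have fin: "finite (Sigma (steps ?N q) (offsets ?N))" for q by (intro finite_SigmaI) auto
  have finW: "finite W" using bij1 fin bij_betw_finite by blast
  have sub: "W2 \<subseteq> W" by (auto simp: W2_def)
  have "node_steps ?N = W - W2" by (auto simp: node_steps_def W_def W2_def)
  then have "card (node_steps ?N) = card W - card W2"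
    using finW sub by (simp add: card_Diff_subset finite_subset)
  moreover have "card W2 \<le> card W" using finW sub by (rule card_mono)
  ultimately show ?thesis
    using bij_betw_same_card[OF bij1] bij_betw_same_card[OF bij2] by (simp add: V_eq_card)
qed

section \<open>Inner nodes as right and left vertices of cells\<close>

lemma node_corner_unique_aux:
  assumes "inbox n s'x s'y" "\<not> inbox n (s'x + x) (s'y - y)" "inbox n (s'x + k * x) (s'y - k * y)" "k \<ge> 1"
  shows False
proof -
  have "inbox n (s'x + x) (s'y - y)"
    by (rule inbox_convex[where c = k and p = "k - 1" and q = 0, OF _ _ _ _ _ assms(3,1,1)])
      (use assms in \<open>simp_all add: algebra_simps\<close>)
  then show False using assms by simp
qed

text \<open>Both \<open>s\<close> lie on the same line parallel to \<open>X\<close>, by the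
  determinant, and each is the last box point on it in direction \<open>X\<close>.\<close>

lemma node_corner_unique:
  assumes d: "side_dir n sx sy \<alpha> \<beta> x y" "side_dir n s'x s'y \<alpha>' \<beta>' x y"
    and s: "inbox n sx sy" "inbox n s'x s'y"
    and t: "sx - \<alpha> = s'x - \<alpha>'" "sy + \<beta> = s'y + \<beta>'"
  shows "sx = s'x \<and> sy = s'y \<and> \<alpha> = \<alpha>' \<and> \<beta> = \<beta>'"
proof -
  have det: "x * \<beta> - y * \<alpha> = 1" "x * \<beta>' - y * \<alpha>' = 1"
    and no: "\<not> inbox n (sx + x) (sy - y)" "\<not> inbox n (s'x + x) (s'y - y)"
    using d by (auto simp: side_dir_def)
  define k where "k = (\<alpha>' - \<alpha>) * \<beta> - (\<beta>' - \<beta>) * \<alpha>"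
  have z: "x * (\<beta>' - \<beta>) = y * (\<alpha>' - \<alpha>)" using det by (simp add: algebra_simps)
  have "\<alpha>' - \<alpha> = (x * \<beta> - y * \<alpha>) * (\<alpha>' - \<alpha>)" "\<beta>' - \<beta> = (x * \<beta> - y * \<alpha>) * (\<beta>' - \<beta>)" by (simp_all add: det)
  moreover have "(x * \<beta> - y * \<alpha>) * (\<alpha>' - \<alpha>) = k * x + \<alpha> * (x * (\<beta>' - \<beta>) - y * (\<alpha>' - \<alpha>))"
    "(x * \<beta> - y * \<alpha>) * (\<beta>' - \<beta>) = k * y + \<beta> * (x * (\<beta>' - \<beta>) - y * (\<alpha>' - \<alpha>))"
    by (simp_all add: k_def algebra_simps)
  ultimately have k: "\<alpha>' - \<alpha> = k * x" "\<beta>' - \<beta> = k * y" using z by simp_all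
  have s': "s'x = sx + k * x" "s'y = sy - k * y" "sx = s'x + (- k) * x" "sy = s'y - (- k) * y"
    using k t by auto
  have "\<not> k \<ge> 1" using node_corner_unique_aux[OF s(1) no(1), of k] s(2) unfolding s'(1,2) by blast
  moreover have "\<not> - k \<ge> 1"
  proof
    assume "- k \<ge> 1"
    then show False using node_corner_unique_aux[OF s(2) no(2), of "- k"] s(1) s'(3,4) by simp
  qed
  ultimately have "k = 0" by linarith
  then show ?thesis using k t by simp
qed

text \<open>The lattice line next to the node line, on the side of the origin, meets the box by
  \<open>level_one_point\<close>, applied with \<open>-X\<close> in the role of
  \<open>(\<alpha>, -\<beta>)\<close> negated, that is, with \<open>t + X\<close> as second point.
  Its last grid point in direction \<open>X\<close> is \<open>s\<close>.\<close>

lemma node_corner_exists: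
  assumes "(tx, ty, x, y) \<in> node_steps n"
  obtains sx sy \<alpha> \<beta> where "corner n sx sy \<alpha> \<beta>" "side_dir n sx sy \<alpha> \<beta> x y"
    "right_vertex n sx sy \<alpha> \<beta> x y" "tx = sx - \<alpha>" "ty = sy + \<beta>"
proof -
  have N: "1 \<le> x" "1 \<le> y" "coprime x y" "inbox n tx ty" "inbox n (tx + x) (ty - y)"
    "\<not> inbox n (tx - x) (ty + y)"
    using assms by (auto simp: node_steps_def)
  have "gcd x y = 1" using N by (simp add: coprime_iff_gcd_eq_1)
  then obtain u v where "u * x + v * y = 1" using bezout_int[of x y] by auto
  then have det0: "(- v) * (- y) - u * (- x) = 1" by (simp add: algebra_simps)
  have "\<exists>k. inbox n (tx + (- v) - k * (- x)) (ty - u + k * (- y))"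
  proof (rule level_one_point[OF N(4) _ det0])
    show "inbox n (tx - - x) (ty + - y)" using N(5) by simp
    show "inbox n 0 0" using N(4) by (simp add: inbox_def)
    have "0 \<le> tx * y" "1 \<le> ty * x"
      using N mult_mono[of 1 ty 1 x] by (auto simp: inbox_def)
    then show "(0 - tx) * (- y) + (0 - ty) * (- x) \<ge> 1" by (simp add: algebra_simps)
  qed simp
  then obtain k where "inbox n (tx - v + k * x) (ty - u - k * y)" by auto
  from exists_max_step[OF this N(1), of y] obtain A where
    A: "inbox n (tx - v + k * x + A * x) (ty - u - k * y - A * y)"
      "\<not> inbox n (tx - v + k * x + (A + 1) * x) (ty - u - k * y - (A + 1) * y)" by metis
  define sx sy where "sx = tx - v + k * x + A * x" and "sy = ty - u - k * y - A * y"
  define \<alpha> \<beta> where "\<alpha> = sx - tx" and "\<beta> = ty - sy"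
  have s: "inbox n sx sy" "\<not> inbox n (sx + x) (sy - y)"
    using A by (auto simp: sx_def sy_def algebra_simps)
  have det: "x * \<beta> - y * \<alpha> = 1"
    using det0 by (simp add: \<alpha>_def \<beta>_def sx_def sy_def algebra_simps)
  \<comment> \<open>Otherwise \<open>s\<close> lies left of \<open>t\<close> and not below it, and
    \<open>t + X\<close> in the box would keep \<open>s + X\<close> in the box.\<close>
  have beta: "\<beta> \<ge> 1"
  proof (rule ccontr)
    assume b: "\<not> \<beta> \<ge> 1"
    then have "x * \<beta> \<le> 0" using N by (simp add: mult_nonneg_nonpos)
    then have "y * \<alpha> < 0" using det by linarith
    then have "\<alpha> < 0" using N by (simp add: mult_less_0_iff)
    then show False using b s N by (auto simp: inbox_def \<alpha>_def \<beta>_def)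
  qed
  then have "x * \<beta> \<ge> 1" using N mult_mono[of 1 x 1 \<beta>] by simp
  then have "y * \<alpha> \<ge> 0" using det by linarith
  then have alpha: "\<alpha> \<ge> 0" using N by (simp add: zero_le_mult_iff)
  have "coprime \<alpha> \<beta>"
  proof (rule coprimeI)
    fix c assume "c dvd \<alpha>" "c dvd \<beta>"
    then have "c dvd x * \<beta> - y * \<alpha>" by simp
    then show "is_unit c" using det by simp
  qed
  then have "corner n sx sy \<alpha> \<beta>"
    using s N alpha beta by (simp add: corner_def \<alpha>_def \<beta>_def)
  moreover have "side_dir n sx sy \<alpha> \<beta> x y" using det s N by (simp add: side_dir_def \<alpha>_def \<beta>_def)
  moreover have "right_vertex n sx sy \<alpha> \<beta> x y" using N by (simp add: right_vertex_def \<alpha>_def \<beta>_def)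
  ultimately show thesis using that by (simp add: \<alpha>_def \<beta>_def)
qed

text \<open>Uniqueness of \<open>X\<close> lets it be added to the data of a corner; then corners
  with a right vertex match inner nodes.\<close>

lemma card_right_corners: "int (card (right_corners (int n))) = V n n 1 - V n n 2"
proof -
  let ?N = "int n"
  define Z where "Z = {(sx, sy, \<alpha>, \<beta>, x, y). corner ?N sx sy \<alpha> \<beta> \<and> side_dir ?N sx sy \<alpha> \<beta> x y \<and>
     right_vertex ?N sx sy \<alpha> \<beta> x y}"
  have inj: "inj_on (\<lambda>(sx, sy, \<alpha>, \<beta>, x, y). (sx, sy, \<alpha>, \<beta>)) Z"
  proof (rule inj_onI, clarsimp simp: Z_def)
    fix sx sy \<alpha> \<beta> x y x' y'
    assume *: "corner ?N sx sy \<alpha> \<beta>" "side_dir ?N sx sy \<alpha> \<beta> x y" "right_vertex ?N sx sy \<alpha> \<beta> x y"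
      "side_dir ?N sx sy \<alpha> \<beta> x' y'" "right_vertex ?N sx sy \<alpha> \<beta> x' y'"
    then show "x = x' \<and> y = y'" using side_dir_unique[OF *(1,2,4)] by blast
  qed
  have img: "(\<lambda>(sx, sy, \<alpha>, \<beta>, x, y). (sx, sy, \<alpha>, \<beta>)) ` Z = right_corners ?N"
    by (force simp: Z_def right_corners_def image_iff)
  have card_Z: "card (right_corners ?N) = card Z" using card_image[OF inj] unfolding img .
  have bij: "bij_betw (\<lambda>(sx, sy, \<alpha>, \<beta>, x, y). (sx - \<alpha>, sy + \<beta>, x, y)) Z (node_steps ?N)"
    unfolding bij_betw_def
  proof (intro conjI)
    show "inj_on (\<lambda>(sx, sy, \<alpha>, \<beta>, x, y). (sx - \<alpha>, sy + \<beta>, x, y)) Z"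
    proof (rule inj_onI, clarsimp simp: Z_def)
      fix sx sy \<alpha> \<beta> x y s'x s'y \<alpha>' \<beta>'
      assume *: "corner ?N sx sy \<alpha> \<beta>" "side_dir ?N sx sy \<alpha> \<beta> x y" "corner ?N s'x s'y \<alpha>' \<beta>'"
        "side_dir ?N s'x s'y \<alpha>' \<beta>' x y" "sx - \<alpha> = s'x - \<alpha>'" "sy + \<beta> = s'y + \<beta>'"
      then show "sx = s'x \<and> sy = s'y \<and> \<alpha> = \<alpha>' \<and> \<beta> = \<beta>'"
        using node_corner_unique[OF *(2,4) _ _ *(5,6)] by (simp add: corner_def)
    qed
    show "(\<lambda>(sx, sy, \<alpha>, \<beta>, x, y). (sx - \<alpha>, sy + \<beta>, x, y)) ` Z = node_steps ?N"
    proof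
      show "(\<lambda>(sx, sy, \<alpha>, \<beta>, x, y). (sx - \<alpha>, sy + \<beta>, x, y)) ` Z \<subseteq> node_steps ?N"
      proof (clarsimp simp: Z_def)
        fix sx sy \<alpha> \<beta> x y
        assume *: "corner ?N sx sy \<alpha> \<beta>" "side_dir ?N sx sy \<alpha> \<beta> x y" "right_vertex ?N sx sy \<alpha> \<beta> x y"
        have "coprime x y"
        proof (rule coprimeI)
          fix c assume "c dvd x" "c dvd y"
          then have "c dvd x * \<beta> - y * \<alpha>" by simp
          then show "is_unit c" using *(2) by (simp add: side_dir_def)
        qed
        then show "(sx - \<alpha>, sy + \<beta>, x, y) \<in> node_steps ?N"
          using * by (simp add: node_steps_def corner_def side_dir_def right_vertex_def)
      qed
      show "node_steps ?N \<subseteq> (\<lambda>(sx, sy, \<alpha>, \<beta>, x, y). (sx - \<alpha>, sy + \<beta>, x, y)) ` Z"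
      proof
        fix q assume "q \<in> node_steps ?N"
        moreover obtain tx ty x y where q: "q = (tx, ty, x, y)" by (cases q)
        ultimately obtain sx sy \<alpha> \<beta> where "corner ?N sx sy \<alpha> \<beta>" "side_dir ?N sx sy \<alpha> \<beta> x y"
          "right_vertex ?N sx sy \<alpha> \<beta> x y" "tx = sx - \<alpha>" "ty = sy + \<beta>"
          using node_corner_exists by metis
        then show "q \<in> (\<lambda>(sx, sy, \<alpha>, \<beta>, x, y). (sx - \<alpha>, sy + \<beta>, x, y)) ` Z"
          by (intro image_eqI[of _ _ "(sx, sy, \<alpha>, \<beta>, x, y)"]) (simp_all add: Z_def q)
      qed
    qed
  qed
  show ?thesis using bij_betw_same_card[OF bij] card_node_steps[of n] card_Z by simp
qed

lemma card_left_corners: "card (left_corners n) = card (right_corners n)"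
proof -
  have "bij_betw (\<lambda>(sx, sy, \<alpha>, \<beta>). (n - sx + \<alpha>, n - sy - \<beta>, \<alpha>, \<beta>)) (right_corners n) (left_corners n)"
    by (rule bij_betwI[where g = "\<lambda>(sx, sy, \<alpha>, \<beta>). (n - sx + \<alpha>, n - sy - \<beta>, \<alpha>, \<beta>)"])
      (auto simp: right_corners_def left_corners_def corner_reflect side_dir_reflect
        left_vertex_reflect right_vertex_reflect, blast+)
  then show ?thesis by (simp add: bij_betw_same_card)
qed

lemma right_Un_left_corners:
  assumes "n \<ge> 1"
  shows "right_corners n \<union> left_corners n = corners n - {(sx, sy, \<alpha>, \<beta>). \<alpha> = n \<and> \<beta> = 1}"
proof
  show "right_corners n \<union> left_corners n \<subseteq> corners n - {(sx, sy, \<alpha>, \<beta>). \<alpha> = n \<and> \<beta> = 1}"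
    using no_side_vertex_special by (auto simp: right_corners_def left_corners_def corners_def)
  show "corners n - {(sx, sy, \<alpha>, \<beta>). \<alpha> = n \<and> \<beta> = 1} \<subseteq> right_corners n \<union> left_corners n"
  proof
    fix z assume z: "z \<in> corners n - {(sx, sy, \<alpha>, \<beta>). \<alpha> = n \<and> \<beta> = 1}"
    obtain sx sy \<alpha> \<beta> where q: "z = (sx, sy, \<alpha>, \<beta>)" by (cases z)
    have *: "corner n sx sy \<alpha> \<beta>" "\<not> (\<alpha> = n \<and> \<beta> = 1)"
      using z by (auto simp: q corners_def)
    then obtain x y where "side_dir n sx sy \<alpha> \<beta> x y"
      "right_vertex n sx sy \<alpha> \<beta> x y \<or> left_vertex n sx sy x y"
      using exists_side_dir[OF *(1) assms] by blast
    then show "z \<in> right_corners n \<union> left_corners n"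
      using * by (auto simp: q right_corners_def left_corners_def)
  qed
qed

text \<open>Inclusion-exclusion: the union consists of all corners except the \<open>n\<close>
  special ones in \<open>E\<close>, and both sets have as many elements as there are inner
  nodes.\<close>

lemma card_right_Int_left_corners:
  assumes "n \<ge> 1"
  shows "int (card (right_corners (int n) \<inter> left_corners (int n))) = V n n 1 - 2 * V n n 2 - (int n)\<^sup>2"
proof -
  let ?N = "int n" and ?R = "right_corners (int n)" and ?L = "left_corners (int n)"
  have sub: "?R \<subseteq> corners ?N" "?L \<subseteq> corners ?N"
    by (auto simp: right_corners_def left_corners_def corners_def)
  then have fin: "finite ?R" "finite ?L" using card_corners(1) finite_subset by blast+
  define E where "E = (\<lambda>j. (?N, j, ?N, 1::int)) ` {0..<?N}"
  have E: "E = corners ?N \<inter> {(sx, sy, \<alpha>, \<beta>). \<alpha> = ?N \<and> \<beta> = 1}"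
    by (auto simp: E_def corners_def corner_def inbox_def image_iff)
  have "card E = n" unfolding E_def by (subst card_image) (auto simp: inj_on_def)
  moreover have "?R \<union> ?L = corners ?N - E" using right_Un_left_corners[of ?N] assms E by auto
  moreover have "E \<subseteq> corners ?N" using E by auto
  ultimately have "card (?R \<union> ?L) = card (corners ?N) - n" "n \<le> card (corners ?N)"
    using card_corners(1)[of n] card_mono[of "corners ?N" E]
    by (auto simp: card_Diff_subset finite_subset)
  then have "int (card (?R \<union> ?L)) = V n n 1 + ?N * (?N + 1) - ?N"
    using card_corners(2)[of n] by simp
  moreover have "int (card ?R) + int (card ?L) = int (card (?R \<union> ?L)) + int (card (?R \<inter> ?L))"
    using card_Un_Int[OF fin] by simp
  ultimately show ?thesis
    using card_right_corners[of n] card_left_corners[of ?N] by (simp add: power2_eq_square algebra_simps)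
qed

text \<open>By uniqueness of \<open>X\<close>, membership in \<open>right_corners\<close> and in
  \<open>left_corners\<close> refers to the same direction, so it can be read off from
  \<open>A \<ge> 1\<close> and \<open>B \<ge> 1\<close>.\<close>

lemma polygon_corner_cell:
  assumes n: "n \<ge> 1" and q: "(sx, sy, \<alpha>, \<beta>) \<in> corners (int n)"
  shows "cell_of n (corner_set n sx sy \<alpha> \<beta>) \<noteq> {}"
    "polygon_with_sides (if (sx, sy, \<alpha>, \<beta>) \<in> right_corners (int n) \<inter> left_corners (int n) then 4 else 3)
       (cell_of n (corner_set n sx sy \<alpha> \<beta>))"
proof -
  let ?C = "cell_of n (corner_set n sx sy \<alpha> \<beta>)" and ?RL = "right_corners (int n) \<inter> left_corners (int n)"
  have c: "corner (int n) sx sy \<alpha> \<beta>" using q by (simp add: corners_def)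
  have "?C \<noteq> {} \<and> polygon_with_sides (if (sx, sy, \<alpha>, \<beta>) \<in> ?RL then 4 else 3) ?C"
  proof (cases "\<alpha> = int n \<and> \<beta> = 1")
    case True
    then have sp: "\<alpha> = int n" "\<beta> = 1" by auto
    have "(sx, sy, \<alpha>, \<beta>) \<notin> ?RL"
      using right_Un_left_corners[of "int n"] n sp by auto
    moreover have "0 \<le> sy" "sy < int n" using c by (auto simp: corner_def inbox_def sp)
    ultimately show ?thesis
      using cell_of_top[of sy n] corner_set_special[of n sx sy] c by (auto simp: sp)
  next
    case False
    obtain x y where d: "side_dir (int n) sx sy \<alpha> \<beta> x y"
      "right_vertex (int n) sx sy \<alpha> \<beta> x y \<or> left_vertex (int n) sx sy x y"
      using exists_side_dir[OF c _ False] n by auto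
    obtain A B where e: "side_extent (int n) sx sy \<alpha> \<beta> x y A B"
      and AB: "A \<ge> 1 \<longleftrightarrow> right_vertex (int n) sx sy \<alpha> \<beta> x y" "B \<ge> 1 \<longleftrightarrow> left_vertex (int n) sx sy x y"
      by (rule exists_side_extent[OF c d])
    have "(sx, sy, \<alpha>, \<beta>) \<in> right_corners (int n) \<longleftrightarrow> right_vertex (int n) sx sy \<alpha> \<beta> x y"
      using side_dir_unique[OF c d(1) _ d(2)] d c unfolding right_corners_def by blast
    moreover have "(sx, sy, \<alpha>, \<beta>) \<in> left_corners (int n) \<longleftrightarrow> left_vertex (int n) sx sy x y"
      using side_dir_unique[OF c d(1) _ d(2)] d c unfolding left_corners_def by blast
    ultimately have "(sx, sy, \<alpha>, \<beta>) \<in> ?RL \<longleftrightarrow> A \<ge> 1 \<and> B \<ge> 1" using AB by simp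
    then show ?thesis using polygon_corner[OF e] by simp
  qed
  then show "?C \<noteq> {}" "polygon_with_sides (if (sx, sy, \<alpha>, \<beta>) \<in> ?RL then 4 else 3) ?C" by auto
qed

theorem theorem4p1:
  fixes n :: nat
  assumes "n \<ge> 1"
  shows "finite (BC_cells n)
    \<and> BC_cells n = BC_triangles n \<union> BC_quadrilaterals n
    \<and> int (card (BC_triangles n)) = T n
    \<and> int (card (BC_quadrilaterals n)) = Q n
    \<and> int (card (BC_cells n)) = T n + Q n"
proof -
  let ?P = "corners (int n)" and ?RL = "right_corners (int n) \<inter> left_corners (int n)"
  define cs where "cs = (\<lambda>(sx, sy, \<alpha>, \<beta>). corner_set n sx sy \<alpha> \<beta>)"
  define bot where "bot j = {w \<in> grid n. fst w \<le> j}" for j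
  let ?B = "bot ` {0..<int n}"
  let ?S = "cs ` ?P \<union> ?B"
  have inj_cs: "inj_on cs ?P"
    by (rule inj_onI) (auto simp: cs_def corners_def dest: corner_set_inj)
  have inj_bot: "inj_on bot {0..<int n}"
  proof (rule inj_onI)
    fix i j assume ij: "i \<in> {0..<int n}" "j \<in> {0..<int n}" "bot i = bot j"
    have "(i, 0) \<in> bot i" "(j, 0) \<in> bot j" using ij(1,2) by (auto simp: bot_def grid_def)
    then have "(i, 0) \<in> bot j" "(j, 0) \<in> bot i" using ij(3) by auto
    then show "i = j" by (simp add: bot_def)
  qed
  \<comment> \<open>A set of the form \<open>bot j\<close> that contains \<open>s\<close> also
    contains \<open>t\<close>, whose first coordinate is not larger.\<close>
  have disj: "cs q \<noteq> bot j" if q: "q \<in> ?P" for q j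
  proof -
    obtain sx sy \<alpha> \<beta> where q': "q = (sx, sy, \<alpha>, \<beta>)" by (cases q)
    then have c: "corner (int n) sx sy \<alpha> \<beta>" using q by (simp add: corners_def)
    have "(sx, sy) \<in> cs q" "(sx - \<alpha>, sy + \<beta>) \<notin> cs q"
      using corner_set_endpoints[OF c] by (auto simp: cs_def q')
    moreover have "(sx - \<alpha>, sy + \<beta>) \<in> bot j" if "(sx, sy) \<in> bot j"
      using that c by (auto simp: bot_def mem_grid corner_def)
    ultimately show ?thesis by metis
  qed
  have poly_cs: "cell_of n (cs q) \<noteq> {}" "polygon_with_sides (if q \<in> ?RL then 4 else 3) (cell_of n (cs q))"
    if "q \<in> ?P" for q
    using polygon_corner_cell[OF assms] that by (cases q; simp add: cs_def)+
  have poly_bot: "cell_of n X \<noteq> {}" "polygon_with_sides 3 (cell_of n X)" if "X \<in> ?B" for X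
    using that cell_of_bottom by (auto simp: bot_def)
  have bounds: "X \<subseteq> grid n \<and> (0, 0) \<in> X \<and> (int n, int n) \<notin> X" if "X \<in> ?S" for X
    using that
  proof
    assume "X \<in> cs ` ?P"
    then obtain sx sy \<alpha> \<beta> where "corner (int n) sx sy \<alpha> \<beta>" "X = corner_set n sx sy \<alpha> \<beta>"
      by (auto simp: cs_def corners_def)
    then show ?thesis using corner_set_bounds[of n sx sy \<alpha> \<beta>] by simp
  next
    assume "X \<in> ?B"
    then show ?thesis by (auto simp: bot_def grid_def)
  qed
  have ne: "cell_of n X \<noteq> {}" if "X \<in> ?S" for X using that poly_cs(1) poly_bot(1) by blast
  have cover: "{w \<in> grid n. chord_fun w p < 0} \<in> ?S"
    if p: "0 < fst p" "fst p < real n" "0 < snd p" "snd p < 1"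
      "\<And>w. w \<in> grid n \<Longrightarrow> chord_fun w p \<noteq> 0" for p
    using generic_point_cell[OF p]
  proof
    assume "\<exists>sx sy \<alpha> \<beta>. corner (int n) sx sy \<alpha> \<beta> \<and> {w \<in> grid n. chord_fun w p < 0} = corner_set n sx sy \<alpha> \<beta>"
    then obtain q where "q \<in> ?P" "{w \<in> grid n. chord_fun w p < 0} = cs q"
      by (auto simp: corners_def cs_def)
    then show ?thesis by blast
  next
    assume "\<exists>j. 0 \<le> j \<and> j < int n \<and> {w \<in> grid n. chord_fun w p < 0} = {w \<in> grid n. fst w \<le> j}"
    then show ?thesis by (auto simp: bot_def)
  qed
  have cells: "BC_cells n = cell_of n ` ?S" and inj: "inj_on (cell_of n) ?S"
    using BC_cells_eq[OF assms bounds ne cover] by blast+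
  have fin: "finite ?P" by (rule card_corners)
  have "card ?S = card (cs ` ?P) + card ?B"
    by (rule card_Un_disjoint) (use fin disj in auto)
  then have card_S: "card ?S = card ?P + n"
    using inj_cs inj_bot by (simp add: card_image)
  have finc: "finite (BC_cells n)" unfolding cells using fin by simp
  have card_cells: "int (card (BC_cells n)) = V n n 1 + (int n)\<^sup>2 + 2 * int n"
    using card_image[OF inj] card_S card_corners(2)[of n] unfolding cells
    by (simp add: power2_eq_square algebra_simps)
  have sub: "?RL \<subseteq> ?P" by (auto simp: right_corners_def corners_def)
  have quads: "BC_quadrilaterals n = cell_of n ` cs ` ?RL"
  proof
    show "cell_of n ` cs ` ?RL \<subseteq> BC_quadrilaterals n"
      unfolding image_image
    proof (rule image_subsetI)
      fix q assume q: "q \<in> ?RL"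
      then have "polygon_with_sides 4 (cell_of n (cs q))" using poly_cs(2)[of q] sub by auto
      then show "cell_of n (cs q) \<in> BC_quadrilaterals n"
        unfolding BC_quadrilaterals_def cells using q sub by blast
    qed
    show "BC_quadrilaterals n \<subseteq> cell_of n ` cs ` ?RL"
    proof
      fix C assume "C \<in> BC_quadrilaterals n"
      then obtain X where X: "X \<in> ?S" "C = cell_of n X" and C4: "polygon_with_sides 4 C"
        unfolding BC_quadrilaterals_def cells by blast
      have "X \<notin> ?B"
      proof
        assume "X \<in> ?B"
        then have "polygon_with_sides 3 C" using poly_bot(2) X(2) by simp
        then show False using polygon_with_sides_unique[OF C4] by force
      qed
      then obtain q where q: "q \<in> ?P" "X = cs q" using X(1) by blast
      have "(if q \<in> ?RL then 4 else 3) = (4::nat)"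
        using polygon_with_sides_unique[OF poly_cs(2)[OF q(1)]] C4 X(2) q(2) by blast
      then have "q \<in> ?RL" by (simp split: if_splits)
      then show "C \<in> cell_of n ` cs ` ?RL" using X(2) q(2) by blast
    qed
  qed
  have card_quads: "int (card (BC_quadrilaterals n)) = Q n"
  proof -
    have "inj_on (cell_of n) (cs ` ?RL)" "inj_on cs ?RL"
      using inj inj_cs sub by (auto intro: inj_on_subset)
    then have "card (BC_quadrilaterals n) = card ?RL" unfolding quads by (simp add: card_image)
    then show ?thesis using card_right_Int_left_corners[OF assms] by (simp add: Q_def)
  qed
  have union: "BC_cells n = BC_triangles n \<union> BC_quadrilaterals n"
  proof -
    have "polygon_with_sides 3 C \<or> polygon_with_sides 4 C" if C: "C \<in> BC_cells n" for C
    proof -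
      obtain X where X: "X \<in> ?S" "C = cell_of n X" using C unfolding cells by blast
      then consider q where "q \<in> ?P" "X = cs q" | "X \<in> ?B" by blast
      then show ?thesis
      proof cases
        case 1
        then show ?thesis using poly_cs(2)[OF 1(1)] X(2) by (cases "q \<in> ?RL") (simp_all only: if_True if_False simp_thms)
      next
        case 2
        then show ?thesis using poly_bot(2) X(2) by simp
      qed
    qed
    then show ?thesis by (auto simp: BC_triangles_def BC_quadrilaterals_def)
  qed
  have "\<not> (polygon_with_sides 3 C \<and> polygon_with_sides 4 C)" for C
    using polygon_with_sides_unique[of 3 C 4] by auto
  then have "BC_triangles n \<inter> BC_quadrilaterals n = {}"
    by (auto simp: BC_triangles_def BC_quadrilaterals_def)
  then have "card (BC_cells n) = card (BC_triangles n) + card (BC_quadrilaterals n)"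
    using finc unfolding union by (intro card_Un_disjoint) auto
  \<comment> \<open>The triangles are counted as the cells that are not quadrilaterals.\<close>
  then have "int (card (BC_triangles n)) = T n"
    using card_cells card_quads by (simp add: T_def Q_def power2_eq_square algebra_simps)
  moreover have "int (card (BC_cells n)) = T n + Q n"
    using card_cells by (simp add: T_def Q_def power2_eq_square algebra_simps)
  ultimately show ?thesis using finc union card_quads by blast
qed

end
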